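(* Let $N\ge3$, $0<\mu<\bar\mu:=\left(\frac{N-2}{2}\right)^2$, $\nu:=\sqrt{\bar\mu}-\sqrt{\bar\mu-\mu}$, $2^*=\frac{2N}{N-2}$, $q>p\ge 2^*-1$, and let $\Omega\subseteq\mathbb{R}^N$ be a smooth domain (bounded or unbounded) with $0\in\Omega$. Consider the problem $$(\ast)\qquad -\Delta u-\mu\frac{u}{|x|^2}=u^p-u^q\ \text{ in }\Omega,\qquad u>0\ \text{ in }\Omega,\qquad u\in H_0^1(\Omega)\cap L^{q+1}(\Omega).$$ (i) If $p=2^*-1$, then for any solution $u$ of $(\ast)$ there exist $C>0$ and a sufficiently small $\rho_0>0$ such that $$u(x)\le C|x|^{-\nu}\qquad\forall\,x\in B_{\rho_0}(0)\setminus\{0\}.$$ (ii) If $p>2^*-1$ and $q>(p-1)\frac N2-1$, then the same conclusion holds: for any solution $u$ of $(\ast)$ there exist $C>0$ and a sufficiently small $\rho_0>0$ such that $u(x)\le C|x|^{-\nu}$ for all $x\in B_{\rho_0}(0)\setminus\{0\}$.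
   Context: $B_r(0)$ is the open ball of radius $r$ centred at $0$. Solutions are understood in the weak sense. *)

theory Defs
  imports "HOL-Analysis.Analysis"
begin

primrec Ck :: "nat \<Rightarrow> ('a::euclidean_space \<Rightarrow> real) \<Rightarrow> bool" where
  "Ck 0 f \<longleftrightarrow> continuous_on UNIV f"
| "Ck (Suc k) f \<longleftrightarrow> (\<forall>x. f differentiable (at x)) \<and>
     (\<forall>b\<in>Basis. Ck k (\<lambda>x. frechet_derivative f (at x) b))"

definition smooth :: "('a::euclidean_space \<Rightarrow> real) \<Rightarrow> bool" where
  "smooth f \<longleftrightarrow> (\<forall>k. Ck k f)"

definition grad :: "('a::euclidean_space \<Rightarrow> real) \<Rightarrow> 'a \<Rightarrow> 'a" where
  "grad f x = (\<Sum>b\<in>Basis. frechet_derivative f (at x) b *\<^sub>R b)"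

text \<open>Near each boundary point the domain is the part lying strictly above the graph of a
  smooth function over a hyperplane \<open>{y. y \<bullet> e = 0}\<close>; the unit vector \<open>e\<close> takes the place of the
  usual ``after a rotation of the coordinate axes''. The function \<open>\<gamma>\<close> is only evaluated on that
  hyperplane; a smooth function there extends to the whole space by composing it with the
  orthogonal projection. No boundedness is required.\<close>

definition smooth_domain :: "'a::euclidean_space set \<Rightarrow> bool" where
  "smooth_domain \<Omega> \<longleftrightarrow> open \<Omega> \<and> connected \<Omega> \<and> \<Omega> \<noteq> {} \<and>
     (\<forall>x0\<in>frontier \<Omega>. \<exists>r>0. \<exists>e \<gamma>. norm e = 1 \<and> smooth \<gamma> \<and>
        \<Omega> \<inter> ball x0 r = {x \<in> ball x0 r. x \<bullet> e > \<gamma> (x - (x \<bullet> e) *\<^sub>R e)})"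

text \<open>Functions are total, but only their values on \<open>\<Omega>\<close> matter, and these only up to null sets.\<close>

definition Lp :: "real \<Rightarrow> 'a::euclidean_space set \<Rightarrow> ('a \<Rightarrow> 'b::euclidean_space) \<Rightarrow> bool" where
  "Lp s \<Omega> f \<longleftrightarrow> f \<in> borel_measurable (lebesgue_on \<Omega>) \<and>
     integrable (lebesgue_on \<Omega>) (\<lambda>x. norm (f x) powr s)"

definition locally_integrable :: "'a::euclidean_space set \<Rightarrow> ('a \<Rightarrow> 'b::euclidean_space) \<Rightarrow> bool" where
  "locally_integrable \<Omega> f \<longleftrightarrow> (\<forall>K. compact K \<and> K \<subseteq> \<Omega> \<longrightarrow> integrable (lebesgue_on K) f)"

definition test_function :: "'a::euclidean_space set \<Rightarrow> ('a \<Rightarrow> real) \<Rightarrow> bool" where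
  "test_function \<Omega> \<phi> \<longleftrightarrow> smooth \<phi> \<and> compact (closure {x. \<phi> x \<noteq> 0}) \<and> closure {x. \<phi> x \<noteq> 0} \<subseteq> \<Omega>"

definition has_weak_gradient ::
    "'a::euclidean_space set \<Rightarrow> ('a \<Rightarrow> real) \<Rightarrow> ('a \<Rightarrow> 'a) \<Rightarrow> bool" where
  "has_weak_gradient \<Omega> u g \<longleftrightarrow> locally_integrable \<Omega> u \<and> locally_integrable \<Omega> g \<and>
     (\<forall>\<phi>. test_function \<Omega> \<phi> \<longrightarrow> (\<forall>b\<in>Basis.
        (LINT x|lebesgue_on \<Omega>. u x * (grad \<phi> x \<bullet> b)) = - (LINT x|lebesgue_on \<Omega>. (g x \<bullet> b) * \<phi> x)))"

text \<open>\<open>H\<^sup>1\<^sub>0(\<Omega>)\<close> is the closure of the test functions in the norm of \<open>H\<^sup>1(\<Omega>)\<close>.\<close>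

definition H01 :: "'a::euclidean_space set \<Rightarrow> ('a \<Rightarrow> real) \<Rightarrow> bool" where
  "H01 \<Omega> u \<longleftrightarrow> Lp 2 \<Omega> u \<and>
     (\<exists>g. has_weak_gradient \<Omega> u g \<and> Lp 2 \<Omega> g \<and>
       (\<exists>\<phi>. (\<forall>k. test_function \<Omega> (\<phi> k)) \<and>
         (\<lambda>k. LINT x|lebesgue_on \<Omega>. (\<phi> k x - u x)\<^sup>2) \<longlonglongrightarrow> 0 \<and>
         (\<lambda>k. LINT x|lebesgue_on \<Omega>. (norm (grad (\<phi> k) x - g x))\<^sup>2) \<longlonglongrightarrow> 0))"

definition mu_bar :: "nat \<Rightarrow> real" where
  "mu_bar N = ((real N - 2) / 2)\<^sup>2"

definition crit_exp :: "nat \<Rightarrow> real" where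
  "crit_exp N = 2 * real N / (real N - 2)"

text \<open>Weak solutions are tested against smooth functions with compact support in \<open>\<Omega>\<close>. The
  weak gradient \<open>g\<close> is unique up to null sets. All integrals below converge absolutely when
  \<open>\<Omega>\<close> is open in dimension at least 3, \<open>u\<close> is in \<open>H01 \<Omega>\<close> and \<open>Lp (q + 1) \<Omega>\<close>, and \<open>0 < p < q\<close>
  (for the Hardy term, by Hardy's inequality), so the default value 0 of the Bochner
  integral does not enter. The value of \<open>powr\<close> at nonpositive bases is irrelevant as
  \<open>u > 0\<close> almost everywhere, and so is the value of \<open>u x / (norm x)\<^sup>2\<close> at the origin.\<close>

definition hardy_solution ::
    "real \<Rightarrow> real \<Rightarrow> real \<Rightarrow> 'a::euclidean_space set \<Rightarrow> ('a \<Rightarrow> real) \<Rightarrow> bool" where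
  "hardy_solution \<mu> p q \<Omega> u \<longleftrightarrow>
     H01 \<Omega> u \<and> Lp (q + 1) \<Omega> u \<and> (AE x in lebesgue_on \<Omega>. u x > 0) \<and>
     (\<exists>g. has_weak_gradient \<Omega> u g \<and>
       (\<forall>\<phi>. test_function \<Omega> \<phi> \<longrightarrow>
          (LINT x|lebesgue_on \<Omega>. g x \<bullet> grad \<phi> x)
            - \<mu> * (LINT x|lebesgue_on \<Omega>. u x / (norm x)\<^sup>2 * \<phi> x)
          = (LINT x|lebesgue_on \<Omega>. u x powr p * \<phi> x)
            - (LINT x|lebesgue_on \<Omega>. u x powr q * \<phi> x)))"

text \<open>The bound \<open>u(x) \<le> C |x|\<^sup>-\<^sup>\<nu>\<close> near the origin. An element of a Sobolev space is determined
  only almost everywhere, so the bound is too; for a representative that is continuous away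
  from the origin it holds at every point.\<close>

definition bounded_by_power_near_0 ::
    "real \<Rightarrow> 'a::euclidean_space set \<Rightarrow> ('a \<Rightarrow> real) \<Rightarrow> bool" where
  "bounded_by_power_near_0 \<nu> \<Omega> u \<longleftrightarrow>
     (\<exists>C>0. \<exists>\<rho>0>0. ball 0 \<rho>0 \<subseteq> \<Omega> \<and>
        (AE x in lebesgue_on (ball 0 \<rho>0 - {0}). u x \<le> C * norm x powr (- \<nu>)) \<and>
        (continuous_on (\<Omega> - {0}) u \<longrightarrow>
           (\<forall>x \<in> ball 0 \<rho>0 - {0}. u x \<le> C * norm x powr (- \<nu>))))"

end

(* The absorption term makes a global comparison possible. Put w = A (|x|^(-nu) + |x|^2). Since nu is
   a root of nu (N - 2 - nu) = mu, away from the origin -Lap w - mu w / |x|^2 = -beta A with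
   beta = mu + 2N, while w >= A everywhere; as s^q - s^p grows faster than s, the function w is a
   supersolution of the equation for large A. The test functions phi approximating u in H^1 are
   bounded, and w blows up at the origin, so psi = w h(phi / w - 1) vanishes near the origin and is
   an admissible test function whenever h is smooth and vanishes on the negative axis. Picone's
   identity gives grad phi . grad psi >= grad w . grad (phi h), and integrating the right-hand side
   by parts turns the equation for u into a bound on the integral of u w h(phi / w - 1) over {u >= w}
   by error terms that are controlled by the H^1 distance of phi and u through Cauchy-Schwarz and
   Hardy's inequality. In the limit u w h(u / w - 1) vanishes on {u >= w}, that is, u <= w. *)

theory Submission
  imports Defs
begin

section \<open>Smooth functions on open sets\<close>

text \<open>Two obstacles shape the estimates. A priori u is neither bounded nor continuous, so it
  cannot enter a test function; only its smooth approximants phi can, and these converge in H^1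
  alone. Hence u^p and u^q are never approximated: they stay functions of u, and only a pointwise
  lower bound of (u^q - u^p) w h is used. On {u >= w} it pays for the deficit beta A and leaves a
  spare u w h; on {u < w} the loss is small because w h <= |u - phi| there. Test functions are
  smooth, so h has to be smooth as well, and exp (-1/t) is chosen. Secondly, the radius within which
  psi vanishes shrinks with the approximant, since w must exceed the supremum of phi there. No
  constant in the final error bound may depend on this radius; Hardy's inequality is therefore used
  with the weight 1 / (|x|^2 + delta) and a constant free of delta. The quadratic term of w keeps w
  >= A far from the origin, where |x|^(-nu) decays. Its price is Lap |x|^2 = 2N together with mu
  |x|^2 / |x|^2 = mu, whence beta.\<close>

primrec Ck_on :: "nat \<Rightarrow> 'a::euclidean_space set \<Rightarrow> ('a \<Rightarrow> real) \<Rightarrow> bool" where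
  "Ck_on 0 S f \<longleftrightarrow> continuous_on S f"
| "Ck_on (Suc k) S f \<longleftrightarrow> (\<forall>x\<in>S. f differentiable (at x)) \<and>
     (\<forall>b\<in>Basis. Ck_on k S (\<lambda>x. frechet_derivative f (at x) b))"

lemma Ck_on_UNIV: "Ck_on k UNIV f \<longleftrightarrow> Ck k f"
  by (induction k arbitrary: f) auto

lemma Ck_on_cong:
  assumes "open S" "\<And>x. x \<in> S \<Longrightarrow> f x = g x" "Ck_on k S f"
  shows "Ck_on k S g"
  using assms(2,3)
proof (induction k arbitrary: f g)
  case 0
  then show ?case by (simp cong: continuous_on_cong)
next
  case (Suc k)
  have d: "(g has_derivative frechet_derivative f (at x)) (at x)" if "x \<in> S" for x
    using Suc.prems that \<open>open S\<close>
    by (meson Ck_on.simps(2) frechet_derivative_works has_derivative_transform_within_open)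
  then have eq: "frechet_derivative g (at x) = frechet_derivative f (at x)" if "x \<in> S" for x
    using that by (metis frechet_derivative_at)
  have "Ck_on k S (\<lambda>x. frechet_derivative g (at x) b)" if "b \<in> Basis" for b
    by (rule Suc.IH[of "\<lambda>x. frechet_derivative f (at x) b"]) (use Suc.prems(2) that eq in simp_all)
  then show ?case
    using d unfolding Ck_on.simps differentiable_def by blast
qed

text \<open>An explicit derivative formula takes the place of \<open>frechet_derivative\<close>. The
  closure rules for products, powers and \<open>flat\<close> go by induction through this rule: the
  partial derivatives are then visibly sums and products covered by the induction
  hypothesis.\<close>

lemma Ck_on_SucI:
  assumes "open S" "\<And>x. x \<in> S \<Longrightarrow> (f has_derivative D x) (at x)"
    and "\<And>b. b \<in> Basis \<Longrightarrow> Ck_on k S (\<lambda>x. D x b)"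
  shows "Ck_on (Suc k) S f"
proof -
  have "frechet_derivative f (at x) = D x" if "x \<in> S" for x
    using assms(2)[OF that] by (metis frechet_derivative_at)
  then have "Ck_on k S (\<lambda>x. frechet_derivative f (at x) b)" if "b \<in> Basis" for b
    using Ck_on_cong[OF assms(1) _ assms(3)[OF that]] by simp
  then show ?thesis
    using assms(2) unfolding Ck_on.simps differentiable_def by blast
qed

lemma Ck_on_SucD: "Ck_on (Suc k) S f \<Longrightarrow> Ck_on k S f"
proof (induction k arbitrary: f)
  case 0
  then show ?case
    by (auto intro!: continuous_at_imp_continuous_on differentiable_imp_continuous_within)
next
  case (Suc k)
  then show ?case by (metis Ck_on.simps(2))
qed

lemma Ck_on_imp_continuous_on: "Ck_on k S f \<Longrightarrow> continuous_on S f"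
proof (induction k)
  case (Suc k)
  then show ?case using Ck_on_SucD by blast
qed simp

lemma Ck_on_subset: "Ck_on k S f \<Longrightarrow> T \<subseteq> S \<Longrightarrow> Ck_on k T f"
  by (induction k arbitrary: f) (auto intro: continuous_on_subset)

lemma Ck_on_Un:
  assumes "open S" "open T" "Ck_on k S f" "Ck_on k T f"
  shows "Ck_on k (S \<union> T) f"
  using assms(3,4)
proof (induction k arbitrary: f)
  case 0
  then show ?case using continuous_on_open_Un[OF assms(1,2)] by simp
next
  case (Suc k)
  then show ?case unfolding Ck_on.simps by blast
qed

lemma Ck_on_const: "open S \<Longrightarrow> Ck_on k S (\<lambda>x. c)"
proof (induction k arbitrary: c)
  case (Suc k)
  show ?case by (rule Ck_on_SucI[OF Suc.prems, where D = "\<lambda>x h. 0"]) (auto simp: Suc)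
qed auto

lemma Ck_on_inner: "open S \<Longrightarrow> Ck_on k S (\<lambda>x. x \<bullet> c)"
proof (induction k)
  case (Suc k)
  show ?case
    by (rule Ck_on_SucI[OF Suc.prems, where D = "\<lambda>x h. h \<bullet> c"])
      (auto simp: Suc.prems Ck_on_const intro!: derivative_eq_intros)
qed (auto intro!: continuous_intros)

lemma Ck_on_Suc_has_derivative:
  "Ck_on (Suc k) S f \<Longrightarrow> x \<in> S \<Longrightarrow> (f has_derivative frechet_derivative f (at x)) (at x)"
  using frechet_derivative_works by auto

lemma Ck_on_Suc_partial:
  "Ck_on (Suc k) S f \<Longrightarrow> b \<in> Basis \<Longrightarrow> Ck_on k S (\<lambda>x. frechet_derivative f (at x) b)"
  by simp

lemma Ck_on_add:
  "open S \<Longrightarrow> Ck_on k S f \<Longrightarrow> Ck_on k S g \<Longrightarrow> Ck_on k S (\<lambda>x. f x + g x)"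
proof (induction k arbitrary: f g)
  case (Suc k)
  have D: "((\<lambda>x. f x + g x) has_derivative
      (\<lambda>h. frechet_derivative f (at x) h + frechet_derivative g (at x) h)) (at x)" if "x \<in> S" for x
    using Ck_on_Suc_has_derivative[OF Suc.prems(2) that] Ck_on_Suc_has_derivative[OF Suc.prems(3) that]
    by (rule has_derivative_add)
  show ?case
    by (rule Ck_on_SucI[OF \<open>open S\<close> D], assumption)
      (intro Suc.IH Suc.prems(1) Ck_on_Suc_partial[OF Suc.prems(2)] Ck_on_Suc_partial[OF Suc.prems(3)];
        assumption)
qed (auto intro!: continuous_intros)

lemma Ck_on_mult:
  "open S \<Longrightarrow> Ck_on k S f \<Longrightarrow> Ck_on k S g \<Longrightarrow> Ck_on k S (\<lambda>x. f x * g x)"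
proof (induction k arbitrary: f g)
  case (Suc k)
  have *: "Ck_on k S f" "Ck_on k S g"
    using Suc.prems Ck_on_SucD by blast+
  have D: "((\<lambda>x. f x * g x) has_derivative
      (\<lambda>h. f x * frechet_derivative g (at x) h + frechet_derivative f (at x) h * g x)) (at x)"
    if "x \<in> S" for x
    using Ck_on_Suc_has_derivative[OF Suc.prems(2) that] Ck_on_Suc_has_derivative[OF Suc.prems(3) that]
    by (rule has_derivative_mult)
  show ?case
    by (rule Ck_on_SucI[OF \<open>open S\<close> D], assumption)
      (intro Ck_on_add Suc.IH Suc.prems(1) * Ck_on_Suc_partial[OF Suc.prems(2)]
        Ck_on_Suc_partial[OF Suc.prems(3)]; assumption)
qed (auto intro!: continuous_intros)

lemma Ck_on_sum:
  "open S \<Longrightarrow> (\<And>i. i \<in> I \<Longrightarrow> Ck_on k S (f i)) \<Longrightarrow> Ck_on k S (\<lambda>x. \<Sum>i\<in>I. f i x)"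
proof (induction I rule: infinite_finite_induct)
  case (insert i I)
  then have "Ck_on k S (\<lambda>x. f i x + (\<Sum>i\<in>I. f i x))"
    by (intro Ck_on_add) auto
  then show ?case using insert by simp
qed (use Ck_on_const in auto)

lemma Ck_on_inner_self: "open S \<Longrightarrow> Ck_on k S (\<lambda>x. x \<bullet> x)"
proof -
  assume "open S"
  then have "Ck_on k S (\<lambda>x. \<Sum>b\<in>Basis. (x \<bullet> b) * (x \<bullet> b))"
    by (intro Ck_on_sum Ck_on_mult Ck_on_inner)
  then show ?thesis by (simp add: euclidean_inner[symmetric])
qed

lemma Ck_on_powr:
  "open S \<Longrightarrow> Ck_on k S f \<Longrightarrow> (\<And>x. x \<in> S \<Longrightarrow> f x > 0) \<Longrightarrow> Ck_on k S (\<lambda>x. f x powr c)"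
proof (induction k arbitrary: c)
  case 0
  then show ?case by (fastforce intro!: continuous_intros)
next
  case (Suc k)
  have f: "Ck_on k S f" using Suc.prems Ck_on_SucD by blast
  have D: "((\<lambda>x. f x powr c) has_derivative
      (\<lambda>h. (c * f x powr (c - 1)) * frechet_derivative f (at x) h)) (at x)" if "x \<in> S" for x
  proof -
    have "(f has_derivative frechet_derivative f (at x)) (at x)"
      using Ck_on_Suc_has_derivative[OF Suc.prems(2) that] .
    from has_derivative_powr[OF this has_derivative_const[of c]] that Suc.prems(3)[OF that]
    show ?thesis
      by (simp add: powr_diff mult_ac)
  qed
  show ?case
    by (rule Ck_on_SucI[OF \<open>open S\<close> D], assumption)
      (intro Ck_on_mult Ck_on_const Suc.IH Suc.prems(1,3) f Ck_on_Suc_partial[OF Suc.prems(2)]; assumption)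
qed

lemma Ck_on_smooth: "smooth f \<Longrightarrow> Ck_on k S f"
  by (metis Ck_on_UNIV Ck_on_subset smooth_def subset_UNIV)

section \<open>The flat function exp (-1/t)\<close>

text \<open>Powers of 1/t are included because differentiating exp (-1/t) produces them; up to
  linear combinations the family is closed under derivatives, which drives the induction for
  smoothness. The cut-off itself is \<open>flat 0\<close>, and its derivative is
  \<open>flat 2\<close>.\<close>

definition flat :: "nat \<Rightarrow> real \<Rightarrow> real" where
  "flat m t = (if t \<le> 0 then 0 else (1 / t) ^ m * exp (- (1 / t)))"

lemma power_le_exp:
  fixes x :: real
  assumes "0 \<le> x"
  shows "x ^ n \<le> real n ^ n * exp x"
proof (cases "n = 0")
  case False
  have "(x / n) ^ n \<le> (1 + x / n) ^ n"
    using assms by (intro power_mono) auto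
  also have "\<dots> \<le> exp x"
    using assms False by (intro exp_ge_one_plus_x_over_n_power_n) auto
  finally show ?thesis
    using False by (simp add: power_divide divide_simps mult_ac)
qed (use assms in auto)

text \<open>This is \<open>power_le_exp\<close> with exponent m + 2 at 1/t. The two spare powers
  become the factor t^2, so the difference quotients at 0 are of order |t| and \<open>flat m\<close>
  has derivative 0 at the junction.\<close>

lemma flat_bound: "\<bar>flat m t\<bar> \<le> real (m + 2) ^ (m + 2) * t\<^sup>2"
proof (cases "t \<le> 0")
  case False
  then have "(1 / t) ^ (m + 2) \<le> real (m + 2) ^ (m + 2) * exp (1 / t)"
    by (intro power_le_exp) auto
  then have "(1 / t) ^ m * exp (- (1 / t)) \<le> real (m + 2) ^ (m + 2) * t\<^sup>2"
    using False by (simp add: power_add divide_simps exp_minus power2_eq_square mult_ac)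
  then show ?thesis using False by (simp add: flat_def)
qed (simp add: flat_def)

lemma flat_has_real_derivative:
  "(flat m has_real_derivative (flat (m + 2) t - real m * flat (m + 1) t)) (at t)"
proof -
  consider "t < 0" | "t = 0" | "t > 0" by linarith
  then show ?thesis
  proof cases
    case 1
    have "((\<lambda>_. 0) has_real_derivative 0) (at t)" by simp
    then have "(flat m has_real_derivative 0) (at t)"
      by (rule has_field_derivative_transform_within[where d="-t"])
        (use 1 in \<open>auto simp: flat_def dist_real_def\<close>)
    then show ?thesis using 1 by (simp add: flat_def)
  next
    case 2
    have "((\<lambda>h. (flat m (0 + h) - flat m 0) / h) \<longlongrightarrow> 0) (at 0)"
    proof (rule Lim_null_comparison)
      show "\<forall>\<^sub>F h in at 0. norm ((flat m (0 + h) - flat m 0) / h) \<le> real (m + 2) ^ (m + 2) * \<bar>h\<bar>"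
      proof (intro eventually_at_filter[THEN iffD2] always_eventually allI impI)
        fix h :: real
        assume "h \<noteq> 0"
        then have "\<bar>flat m h\<bar> / \<bar>h\<bar> \<le> real (m + 2) ^ (m + 2) * h\<^sup>2 / \<bar>h\<bar>"
          by (intro divide_right_mono flat_bound) auto
        also have "h\<^sup>2 / \<bar>h\<bar> = \<bar>h\<bar>"
          by (metis abs_power2 nonzero_mult_div_cancel_right \<open>h \<noteq> 0\<close> abs_0_eq power2_abs power2_eq_square)
        then have "real (m + 2) ^ (m + 2) * h\<^sup>2 / \<bar>h\<bar> = real (m + 2) ^ (m + 2) * \<bar>h\<bar>"
          by (metis times_divide_eq_right)
        finally show "norm ((flat m (0 + h) - flat m 0) / h) \<le> real (m + 2) ^ (m + 2) * \<bar>h\<bar>"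
          by (simp add: flat_def[of m 0])
      qed
      show "((\<lambda>h. real (m + 2) ^ (m + 2) * \<bar>h\<bar>) \<longlongrightarrow> 0) (at 0)"
        by (auto intro!: tendsto_eq_intros)
    qed
    then show ?thesis using 2 by (simp add: DERIV_def flat_def)
  next
    case 3
    have inv: "((\<lambda>t. 1 / t) has_real_derivative - (1 / t)\<^sup>2) (at t)"
      using 3 by (auto intro!: derivative_eq_intros simp: power2_eq_square)
    have "((\<lambda>t. (1 / t) ^ m) has_real_derivative - real m * (1 / t) ^ (m + 1)) (at t)"
    proof (cases m)
      case (Suc n)
      show ?thesis
        by (rule DERIV_cong[OF DERIV_power[OF inv]]) (simp add: Suc power2_eq_square del: of_nat_Suc)
    qed simp
    moreover have "((\<lambda>t. exp (- (1 / t))) has_real_derivative (1 / t)\<^sup>2 * exp (- (1 / t))) (at t)"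
      using DERIV_chain2[OF DERIV_exp DERIV_minus[OF inv]] by (simp add: mult_ac)
    ultimately have "((\<lambda>t. (1 / t) ^ m * exp (- (1 / t))) has_real_derivative
        - real m * (1 / t) ^ (m + 1) * exp (- (1 / t)) + (1 / t)\<^sup>2 * exp (- (1 / t)) * (1 / t) ^ m) (at t)"
      by (rule DERIV_mult)
    moreover have "- real m * (1 / t) ^ (m + 1) * exp (- (1 / t)) + (1 / t)\<^sup>2 * exp (- (1 / t)) * (1 / t) ^ m
        = flat (m + 2) t - real m * flat (m + 1) t"
      using 3 by (simp add: flat_def power2_eq_square mult_ac)
    ultimately have "((\<lambda>t. (1 / t) ^ m * exp (- (1 / t))) has_real_derivative
        (flat (m + 2) t - real m * flat (m + 1) t)) (at t)"
      by metis
    then show ?thesis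
      by (rule has_field_derivative_transform_within[where d=t])
        (use 3 in \<open>auto simp: flat_def dist_real_def\<close>)
  qed
qed

lemma Ck_on_flat: "open S \<Longrightarrow> Ck_on k S f \<Longrightarrow> Ck_on k S (\<lambda>x. flat m (f x))"
proof (induction k arbitrary: m)
  case 0
  have "continuous_on UNIV (flat m)"
    by (rule DERIV_continuous_on[OF has_field_derivative_at_within[OF flat_has_real_derivative]])
  then show ?case
    using 0 continuous_on_compose2[of UNIV "flat m" S f] by simp
next
  case (Suc k)
  have f: "Ck_on k S f" using Suc.prems Ck_on_SucD by blast
  have D: "((\<lambda>x. flat m (f x)) has_derivative
      (\<lambda>h. (flat (m + 2) (f x) + (- real m) * flat (m + 1) (f x)) * frechet_derivative f (at x) h)) (at x)"
    if "x \<in> S" for x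
  proof -
    have "(f has_derivative frechet_derivative f (at x)) (at x)"
      using Ck_on_Suc_has_derivative[OF Suc.prems(2) that] .
    from has_derivative_compose[OF this flat_has_real_derivative[of m "f x", unfolded has_field_derivative_def]]
    show ?thesis by simp
  qed
  show ?case
    by (rule Ck_on_SucI[OF \<open>open S\<close> D], assumption)
      (intro Ck_on_mult Ck_on_add Ck_on_const Suc.IH Suc.prems(1) f Ck_on_Suc_partial[OF Suc.prems(2)]; assumption)
qed

lemma flat_nonneg: "0 \<le> flat m t"
  by (simp add: flat_def)

lemma flat_nonpos_eq [simp]: "t \<le> 0 \<Longrightarrow> flat m t = 0"
  by (simp add: flat_def)

lemma flat_pos: "0 < t \<Longrightarrow> 0 < flat m t"
  by (simp add: flat_def)

lemma flat_0_le: "flat 0 t \<le> max t 0"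
proof (cases "t \<le> 0")
  case False
  have "1 / t \<le> exp (1 / t)"
    using exp_ge_add_one_self[of "1 / t"] by linarith
  then show ?thesis using False by (simp add: flat_def exp_minus divide_simps mult_ac)
qed simp

text \<open>With s = 1/t this is s^2 / 2 <= exp s. As \<open>flat 2\<close> is the derivative of
  \<open>flat 0\<close>, it is the source of the factor 2 in the Lipschitz bound and in the gradient
  estimate for the test function.\<close>

lemma flat_2_le: "flat 2 t \<le> 2"
proof (cases "t \<le> 0")
  case False
  have "(1 / t)\<^sup>2 / 2 \<le> exp (1 / t)"
    using exp_lower_Taylor_quadratic[of "1 / t"] False by (smt (verit) zero_le_divide_1_iff)
  then show ?thesis using False by (simp add: flat_def exp_minus divide_simps mult_ac)
qed simp

lemma flat_0_lipschitz: "\<bar>flat 0 s - flat 0 t\<bar> \<le> 2 * \<bar>s - t\<bar>"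
proof -
  have "norm (flat 0 s - flat 0 t) \<le> 2 * norm (s - t)"
    by (rule field_differentiable_bound[of UNIV _ "flat 2"])
      (use flat_has_real_derivative[of 0] flat_2_le flat_nonneg in \<open>auto simp: numeral_2_eq_2\<close>)
  then show ?thesis by simp
qed

section \<open>Integration by parts\<close>

lemma continuous_compact_support_bounded:
  fixes f :: "'a::euclidean_space \<Rightarrow> real"
  assumes "continuous_on UNIV f" "compact K" "\<And>x. x \<notin> K \<Longrightarrow> f x = 0"
  obtains M where "M \<ge> 0" "\<And>x. \<bar>f x\<bar> \<le> M"
proof -
  have "bounded (f ` K)"
    using assms by (intro compact_imp_bounded compact_continuous_image) (auto intro: continuous_on_subset)
  then obtain M where "\<forall>y\<in>f ` K. norm y \<le> M"
    unfolding bounded_iff by blast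
  then have "\<bar>f x\<bar> \<le> max M 0" for x
    using assms(3)[of x] by (cases "x \<in> K") fastforce+
  then show ?thesis using that[of "max M 0"] by simp
qed

lemma integrable_continuous_compact_support:
  fixes f :: "'a::euclidean_space \<Rightarrow> real"
  assumes "continuous_on UNIV f" "compact K" "\<And>x. x \<notin> K \<Longrightarrow> f x = 0"
  shows "integrable lborel f"
proof -
  have "integrable lborel (\<lambda>x. indicator K x *\<^sub>R f x)"
    using assms by (intro borel_integrable_compact) (auto intro: continuous_on_subset)
  moreover have "(\<lambda>x. indicator K x *\<^sub>R f x) = f"
    using assms(3) by (auto simp: indicator_def fun_eq_iff)
  ultimately show ?thesis by simp
qed

text \<open>The weak formulation lives on \<open>lebesgue_on \<Omega>\<close>, while translation
  invariance is used for \<open>lborel\<close>; this is the bridge between them. Borel measurability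
  permits the passage through the completion.\<close>

lemma lebesgue_on_vanishing_outside:
  fixes f :: "'a::euclidean_space \<Rightarrow> real"
  assumes "S \<in> sets lebesgue" "f \<in> borel_measurable borel" "\<And>x. x \<notin> S \<Longrightarrow> f x = 0"
  shows "integrable (lebesgue_on S) f \<longleftrightarrow> integrable lborel f"
    and "(LINT x|lebesgue_on S. f x) = (LINT x|lborel. f x)"
proof -
  have "(\<lambda>x. indicator S x *\<^sub>R f x) = f"
    using assms(3) by (auto simp: indicator_def fun_eq_iff)
  then show "integrable (lebesgue_on S) f \<longleftrightarrow> integrable lborel f"
    and "(LINT x|lebesgue_on S. f x) = (LINT x|lborel. f x)"
    using assms by (simp_all add: integrable_restrict_space integral_restrict_space
        integrable_completion integral_completion)
qed

lemma has_derivative_vanishing_outside: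
  fixes f :: "'a::euclidean_space \<Rightarrow> real"
  assumes "(f has_derivative D) (at x)" "closed K" "\<And>x. x \<notin> K \<Longrightarrow> f x = 0" "x \<notin> K"
  shows "D = (\<lambda>_. 0)"
proof -
  have "(f has_derivative (\<lambda>_. 0)) (at x)"
    by (rule has_derivative_transform_within_open[of "\<lambda>_. 0" _ _ _ "- K"]) (use assms in auto)
  with assms(1) show ?thesis by (rule has_derivative_unique)
qed

text \<open>The integral of a difference quotient of \<open>f\<close> vanishes by translation invariance; the
  quotients converge dominatedly to the directional derivative.\<close>

lemma integral_directional_derivative_eq_0:
  fixes f :: "'a::euclidean_space \<Rightarrow> real"
  assumes D: "\<And>x. (f has_derivative D x) (at x)"
    and cont: "continuous_on UNIV (\<lambda>x. D x b)"
    and K: "compact K" "\<And>x. x \<notin> K \<Longrightarrow> f x = 0"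
  shows "(LINT x|lborel. D x b) = 0"
proof -
  have "D x b = 0" if "x \<notin> K" for x
    using has_derivative_vanishing_outside[OF D compact_imp_closed[OF K(1)] K(2) that] by simp
  then obtain M where M: "M \<ge> 0" "\<And>x. \<bar>D x b\<bar> \<le> M"
    using continuous_compact_support_bounded[OF cont K(1)] by blast
  obtain R where R: "\<And>x. x \<in> K \<Longrightarrow> norm x \<le> R"
    using compact_imp_bounded[OF K(1)] unfolding bounded_iff by blast
  have f_cont: "continuous_on UNIV f"
    using D has_derivative_continuous_on has_derivative_at_withinI by blast
  have f_int: "integrable lborel f"
    by (rule integrable_continuous_compact_support[OF f_cont K])
  define t where "t n = inverse (real (Suc n))" for n
  have t: "t n > 0" "t n \<le> 1" for n
    by (auto simp: t_def divide_simps)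
  define s where "s n x = (f (t n *\<^sub>R b + x) - f x) / t n" for n x
  have line: "((\<lambda>r. f (r *\<^sub>R b + x)) has_real_derivative D (r *\<^sub>R b + x) b) (at r within S)" for r x S
  proof -
    have "((\<lambda>r. r *\<^sub>R b + x) has_derivative (\<lambda>h. h *\<^sub>R b)) (at r within S)"
      by (auto intro!: derivative_eq_intros)
    from has_derivative_compose[OF this D[of "r *\<^sub>R b + x"]]
    have "((\<lambda>r. f (r *\<^sub>R b + x)) has_derivative (\<lambda>h. D (r *\<^sub>R b + x) (h *\<^sub>R b))) (at r within S)"
      by simp
    moreover have "D (r *\<^sub>R b + x) (h *\<^sub>R b) = D (r *\<^sub>R b + x) b * h" for h
      using linear_scale[OF has_derivative_linear[OF D[of "r *\<^sub>R b + x"]]] by simp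
    ultimately show ?thesis
      unfolding has_field_derivative_def by simp
  qed
  have bound: "\<bar>s n x\<bar> \<le> M" for n x
  proof -
    have "\<exists>r\<in>{0..t n}. f (t n *\<^sub>R b + x) - f (0 *\<^sub>R b + x) = D (r *\<^sub>R b + x) b * (t n - 0)"
      using t(1)[of n] line[unfolded has_field_derivative_def] by (intro mvt_very_simple) auto
    then obtain r where "f (t n *\<^sub>R b + x) - f x = D (r *\<^sub>R b + x) b * t n"
      by auto
    then show ?thesis
      using M(2) t(1)[of n] by (simp add: s_def)
  qed
  \<comment> \<open>As \<open>t n \<le> 1\<close>, a shift moves the support by at most
    \<open>norm b\<close>. One ball therefore serves all quotients, and \<open>M\<close> times its
    indicator is the integrable majorant.\<close>
  have supp: "s n x = 0" if "x \<notin> cball 0 (R + norm b)" for n x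
  proof -
    have *: "norm x > R + norm b" using that by simp
    have "norm (t n *\<^sub>R b) \<le> norm b"
      using t[of n] by (simp add: mult_left_le_one_le)
    moreover have "norm x \<le> norm (t n *\<^sub>R b + x) + norm (t n *\<^sub>R b)"
      by (metis add_diff_cancel_left' norm_triangle_ineq4)
    ultimately have "t n *\<^sub>R b + x \<notin> K" "x \<notin> K"
      using * R norm_ge_zero[of b] by fastforce+
    then show ?thesis using K(2) by (simp add: s_def)
  qed
  have int0: "(LINT x|lborel. s n x) = 0" for n
  proof -
    have "integrable (distr lborel borel ((+) (t n *\<^sub>R b))) f"
      unfolding lborel_distr_plus by (rule f_int)
    then have sh: "integrable lborel (\<lambda>x. f (t n *\<^sub>R b + x))"
      by (subst (asm) integrable_distr_eq) (use f_int in auto)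
    have "(LINT x|lborel. f (t n *\<^sub>R b + x)) = (LINT x|distr lborel borel ((+) (t n *\<^sub>R b)). f x)"
      by (subst integral_distr) (use f_int in auto)
    also have "\<dots> = (LINT x|lborel. f x)"
      unfolding lborel_distr_plus ..
    finally show ?thesis
      using sh f_int by (simp add: s_def)
  qed
  have lim: "(\<lambda>n. s n x) \<longlonglongrightarrow> D x b" for x
  proof -
    have "filterlim t (at 0) sequentially"
      using t LIMSEQ_inverse_real_of_nat unfolding t_def[abs_def] by (intro filterlim_atI) auto
    moreover have "((\<lambda>h. (f (h *\<^sub>R b + x) - f x) / h) \<longlongrightarrow> D x b) (at 0)"
      using line[of x 0 UNIV] by (simp add: DERIV_def)
    ultimately show ?thesis
      unfolding s_def by (rule filterlim_compose[rotated])
  qed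
  have "(\<lambda>n. LINT x|lborel. s n x) \<longlonglongrightarrow> (LINT x|lborel. D x b)"
  proof (rule integral_dominated_convergence)
    show "(\<lambda>x. D x b) \<in> borel_measurable lborel"
      using cont by (simp add: borel_measurable_continuous_onI)
    show "s n \<in> borel_measurable lborel" for n
    proof -
      have "continuous_on UNIV (s n)"
        unfolding s_def[abs_def]
        using t(1)[of n]
        by (intro continuous_intros continuous_on_compose2[OF f_cont] f_cont) auto
      then show ?thesis by (simp add: borel_measurable_continuous_onI)
    qed
    show "integrable lborel (\<lambda>x. M * indicator (cball 0 (R + norm b)) x)"
      using emeasure_compact_finite[OF compact_cball] by (intro integrable_mult_right integrable_real_indicator) auto
    show "AE x in lborel. norm (s n x) \<le> M * indicator (cball 0 (R + norm b)) x" for n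
      using bound supp by (auto simp: indicator_def)
  qed (use lim in auto)
  then show ?thesis
    unfolding int0 using LIMSEQ_unique tendsto_const by metis
qed

section \<open>Square integrable functions\<close>

definition L2 :: "'a measure \<Rightarrow> ('a \<Rightarrow> real) \<Rightarrow> bool" where
  "L2 M f \<longleftrightarrow> f \<in> borel_measurable M \<and> integrable M (\<lambda>x. (f x)\<^sup>2)"

lemma L2_measurable: "L2 M f \<Longrightarrow> f \<in> borel_measurable M"
  by (simp add: L2_def)

lemma L2_integrable_square: "L2 M f \<Longrightarrow> integrable M (\<lambda>x. (f x)\<^sup>2)"
  by (simp add: L2_def)

lemma L2_dominated:
  assumes "f \<in> borel_measurable M" "L2 M g" "\<And>x. x \<in> space M \<Longrightarrow> \<bar>f x\<bar> \<le> C * \<bar>g x\<bar>"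
  shows "L2 M f"
  unfolding L2_def
proof
  show "integrable M (\<lambda>x. (f x)\<^sup>2)"
  proof (rule Bochner_Integration.integrable_bound)
    show "integrable M (\<lambda>x. C\<^sup>2 * (g x)\<^sup>2)"
      using assms(2) by (auto simp: L2_def)
    show "(\<lambda>x. (f x)\<^sup>2) \<in> borel_measurable M"
      using assms(1) by simp
    show "AE x in M. norm ((f x)\<^sup>2) \<le> norm (C\<^sup>2 * (g x)\<^sup>2)"
    proof (rule AE_I2)
      fix x assume "x \<in> space M"
      then have "\<bar>f x\<bar>\<^sup>2 \<le> (C * \<bar>g x\<bar>)\<^sup>2"
        using assms(3) by (intro power_mono) auto
      then show "norm ((f x)\<^sup>2) \<le> norm (C\<^sup>2 * (g x)\<^sup>2)"
        by (simp add: power_mult_distrib)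
    qed
  qed
qed fact

lemma L2_mult_integrable:
  assumes "L2 M f" "L2 M g"
  shows "integrable M (\<lambda>x. f x * g x)"
proof (rule Bochner_Integration.integrable_bound)
  show "integrable M (\<lambda>x. (f x)\<^sup>2 + (g x)\<^sup>2)"
    using assms by (auto simp: L2_def)
  show "(\<lambda>x. f x * g x) \<in> borel_measurable M"
    using assms by (auto simp: L2_def)
  have "\<bar>a * b\<bar> \<le> a\<^sup>2 + b\<^sup>2" for a b :: real
  proof -
    have "2 * \<bar>a * b\<bar> \<le> a\<^sup>2 + b\<^sup>2"
      using sum_squares_bound[of "\<bar>a\<bar>" "\<bar>b\<bar>"] by (simp add: abs_mult mult.assoc)
    then show ?thesis using abs_ge_zero[of "a * b"] by linarith
  qed
  then show "AE x in M. norm (f x * g x) \<le> norm ((f x)\<^sup>2 + (g x)\<^sup>2)"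
    by (auto simp: abs_of_nonneg)
qed

lemma L2_abs: "L2 M f \<Longrightarrow> L2 M (\<lambda>x. \<bar>f x\<bar>)"
  by (auto simp: L2_def)

lemma L2_add:
  assumes "L2 M f" "L2 M g"
  shows "L2 M (\<lambda>x. f x + g x)"
proof -
  have "integrable M (\<lambda>x. (f x)\<^sup>2 + (g x)\<^sup>2 + 2 * (f x * g x))"
    using assms L2_mult_integrable[OF assms] unfolding L2_def by (intro Bochner_Integration.integrable_add integrable_mult_right) auto
  then show ?thesis
    using assms by (auto simp: L2_def power2_sum mult.assoc)
qed

lemma L2_scale: "L2 M f \<Longrightarrow> L2 M (\<lambda>x. c * f x)"
  by (auto simp: L2_def power_mult_distrib)

lemma L2_diff:
  assumes "L2 M f" "L2 M g"
  shows "L2 M (\<lambda>x. f x - g x)"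
  using L2_add[OF assms(1) L2_scale[OF assms(2), of "-1"]] by simp

text \<open>The integral of (s |f| - |g|)^2 is a nonnegative quadratic polynomial in s. Evaluating
  it at its minimum s = I / F gives the inequality; F = 0 has to be treated apart.\<close>

lemma L2_Cauchy_Schwarz:
  assumes "L2 M f" "L2 M g"
  shows "(LINT x|M. \<bar>f x\<bar> * \<bar>g x\<bar>) \<le> sqrt (LINT x|M. (f x)\<^sup>2) * sqrt (LINT x|M. (g x)\<^sup>2)"
proof -
  define F where "F = (LINT x|M. (f x)\<^sup>2)"
  define G where "G = (LINT x|M. (g x)\<^sup>2)"
  define I where "I = (LINT x|M. \<bar>f x\<bar> * \<bar>g x\<bar>)"
  have pos: "F \<ge> 0" "G \<ge> 0" "I \<ge> 0" by (auto simp: F_def G_def I_def)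
  have quad: "0 \<le> s\<^sup>2 * F - 2 * s * I + G" for s
  proof -
    have "(s * \<bar>a\<bar> - \<bar>b\<bar>)\<^sup>2 = s\<^sup>2 * a\<^sup>2 - 2 * s * (\<bar>a\<bar> * \<bar>b\<bar>) + b\<^sup>2" for a b :: real
      by (simp add: power2_diff power_mult_distrib mult.assoc)
    then have "(LINT x|M. (s * \<bar>f x\<bar> - \<bar>g x\<bar>)\<^sup>2) =
        (LINT x|M. s\<^sup>2 * (f x)\<^sup>2 - 2 * s * (\<bar>f x\<bar> * \<bar>g x\<bar>) + (g x)\<^sup>2)"
      by simp
    also have "\<dots> = s\<^sup>2 * F - 2 * s * I + G"
      using assms L2_mult_integrable[OF L2_abs[OF assms(1)] L2_abs[OF assms(2)]]
      by (simp add: F_def G_def I_def L2_def)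
    moreover have "0 \<le> (LINT x|M. (s * \<bar>f x\<bar> - \<bar>g x\<bar>)\<^sup>2)"
      by (rule Bochner_Integration.integral_nonneg) simp
    ultimately show ?thesis by simp
  qed
  have "I\<^sup>2 \<le> F * G"
  proof (cases "F = 0")
    case True
    have "I = 0"
    proof (rule ccontr)
      assume "I \<noteq> 0"
      \<comment> \<open>For F = 0 the polynomial is G - 2 s I, which this choice of s turns into - G
        - 2.\<close>
      then show False
        using quad[of "(G + 1) / I"] pos by (simp add: True)
    qed
    then show ?thesis by (simp add: True)
  next
    case False
    have "0 \<le> F * ((I / F)\<^sup>2 * F - 2 * (I / F) * I + G)"
      using quad[of "I / F"] pos by simp
    also have "\<dots> = F * G - I\<^sup>2"
      using False by (simp add: power2_eq_square field_simps)
    finally show ?thesis by simp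
  qed
  then have "I \<le> sqrt (F * G)"
    by (rule real_le_rsqrt)
  then show ?thesis by (simp add: real_sqrt_mult F_def G_def I_def)
qed

definition L2_norm :: "'a measure \<Rightarrow> ('a \<Rightarrow> real) \<Rightarrow> real" where
  "L2_norm M f = sqrt (LINT x|M. (f x)\<^sup>2)"

lemma L2_norm_nonneg: "0 \<le> L2_norm M f"
  by (simp add: L2_norm_def)

lemma L2_norm_mono:
  assumes "f \<in> borel_measurable M" "L2 M g" "0 \<le> c" "\<And>x. x \<in> space M \<Longrightarrow> \<bar>f x\<bar> \<le> c * \<bar>g x\<bar>"
  shows "L2_norm M f \<le> c * L2_norm M g"
proof -
  have f: "L2 M f" using L2_dominated[OF assms(1,2,4)] .
  have "(LINT x|M. (f x)\<^sup>2) \<le> (LINT x|M. c\<^sup>2 * (g x)\<^sup>2)"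
  proof (rule integral_mono)
    fix x assume "x \<in> space M"
    then have "\<bar>f x\<bar>\<^sup>2 \<le> (c * \<bar>g x\<bar>)\<^sup>2"
      using assms(4) by (intro power_mono) auto
    then show "(f x)\<^sup>2 \<le> c\<^sup>2 * (g x)\<^sup>2" by (simp add: power_mult_distrib)
  qed (use f assms(2) in \<open>auto simp: L2_def\<close>)
  then have "sqrt (LINT x|M. (f x)\<^sup>2) \<le> sqrt (c\<^sup>2 * (LINT x|M. (g x)\<^sup>2))"
    by (intro real_sqrt_le_mono) simp
  then show ?thesis using assms(3) by (simp add: L2_norm_def real_sqrt_mult)
qed

lemma L2_norm_triangle:
  assumes "L2 M f" "L2 M g"
  shows "L2_norm M (\<lambda>x. f x + g x) \<le> L2_norm M f + L2_norm M g"
proof -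
  note i = L2_integrable_square[OF assms(1)] L2_integrable_square[OF assms(2)]
    L2_mult_integrable[OF L2_abs[OF assms(1)] L2_abs[OF assms(2)]]
  have le: "(f x + g x)\<^sup>2 \<le> (f x)\<^sup>2 + (g x)\<^sup>2 + 2 * (\<bar>f x\<bar> * \<bar>g x\<bar>)" for x
    using abs_ge_self[of "f x * g x"] by (simp add: power2_sum abs_mult)
  have "(LINT x|M. (f x + g x)\<^sup>2) \<le> (LINT x|M. (f x)\<^sup>2 + (g x)\<^sup>2 + 2 * (\<bar>f x\<bar> * \<bar>g x\<bar>))"
    by (intro integral_mono L2_integrable_square[OF L2_add[OF assms]] le Bochner_Integration.integrable_add
        integrable_mult_right i)
  also have "\<dots> = (L2_norm M f)\<^sup>2 + (L2_norm M g)\<^sup>2 + 2 * (LINT x|M. \<bar>f x\<bar> * \<bar>g x\<bar>)"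
    using i by (simp add: L2_norm_def)
  also have "\<dots> \<le> (L2_norm M f + L2_norm M g)\<^sup>2"
    using L2_Cauchy_Schwarz[OF assms] by (simp add: power2_sum L2_norm_def)
  finally have "sqrt (LINT x|M. (f x + g x)\<^sup>2) \<le> sqrt ((L2_norm M f + L2_norm M g)\<^sup>2)"
    by (rule real_sqrt_le_mono)
  then show ?thesis using L2_norm_nonneg[of M f] L2_norm_nonneg[of M g] by (simp add: L2_norm_def)
qed

lemma L2_Cauchy_Schwarz_scaled:
  assumes "L2 M f" "L2 M g" "c \<ge> 0"
  shows "(LINT x|M. c * (\<bar>f x\<bar> * \<bar>g x\<bar>)) \<le> c * (L2_norm M f * L2_norm M g)"
  using mult_left_mono[OF L2_Cauchy_Schwarz[OF assms(1,2)] assms(3)] by (simp add: L2_norm_def)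

lemma L2_norm_diff:
  assumes "g \<in> borel_measurable M" "L2 M (\<lambda>x. norm (g x))" "f \<in> borel_measurable M" "L2 M (\<lambda>x. norm (f x))"
  shows "L2 M (\<lambda>x. norm (g x - f x :: 'a::euclidean_space))"
proof (rule L2_dominated[where C = 1])
  show "L2 M (\<lambda>x. norm (g x) + norm (f x))" by (rule L2_add[OF assms(2,4)])
  show "(\<lambda>x. norm (g x - f x)) \<in> borel_measurable M" using assms(1,3) by measurable
  show "\<bar>norm (g x - f x)\<bar> \<le> 1 * \<bar>norm (g x) + norm (f x)\<bar>" for x
    using norm_triangle_ineq4[of "g x" "f x"] by simp
qed


section \<open>Test functions and Hardy's inequality\<close>

lemma borel_measurable_lebesgue_on_continuous:
  fixes f :: "'a::euclidean_space \<Rightarrow> 'b::euclidean_space"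
  shows "continuous_on UNIV f \<Longrightarrow> f \<in> borel_measurable (lebesgue_on S)"
  by (simp add: measurable_completion measurable_restrict_space1 borel_measurable_continuous_onI)

lemma test_function_Ck_on: "test_function \<Omega> \<phi> \<Longrightarrow> Ck_on k S \<phi>"
  by (simp add: test_function_def Ck_on_smooth)

lemma grad_inner_Basis: "b \<in> Basis \<Longrightarrow> grad f x \<bullet> b = frechet_derivative f (at x) b"
  by (simp add: grad_def)

lemma differentiable_has_derivative_grad:
  assumes "f differentiable (at x)"
  shows "(f has_derivative (\<lambda>h. grad f x \<bullet> h)) (at x)"
proof -
  have D: "(f has_derivative frechet_derivative f (at x)) (at x)"
    using assms frechet_derivative_works by blast
  interpret linear "frechet_derivative f (at x)"
    using D by (rule has_derivative_linear)
  have "frechet_derivative f (at x) h = grad f x \<bullet> h" for h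
  proof -
    have "frechet_derivative f (at x) h = frechet_derivative f (at x) (\<Sum>b\<in>Basis. (h \<bullet> b) *\<^sub>R b)"
      by (simp add: euclidean_representation)
    also have "\<dots> = (\<Sum>b\<in>Basis. (h \<bullet> b) * frechet_derivative f (at x) b)"
      by (simp add: sum scale)
    also have "\<dots> = grad f x \<bullet> h"
      by (simp add: grad_def inner_sum_left inner_commute[of h] mult.commute)
    finally show ?thesis .
  qed
  then show ?thesis using D by presburger
qed

lemma grad_eqI:
  assumes "(f has_derivative (\<lambda>h. v \<bullet> h)) (at x)"
  shows "grad f x = v"
proof -
  have "frechet_derivative f (at x) = (\<lambda>h. v \<bullet> h)"
    using assms by (metis frechet_derivative_at)
  then show ?thesis by (simp add: grad_def euclidean_representation)
qed

lemma smooth_has_derivative_grad: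
  assumes "smooth f"
  shows "(f has_derivative (\<lambda>h. grad f x \<bullet> h)) (at x)"
proof -
  have "Ck 1 f" using assms smooth_def by blast
  then show ?thesis by (intro differentiable_has_derivative_grad) simp
qed

lemma continuous_on_smooth: "smooth f \<Longrightarrow> continuous_on S f"
  using Ck_on_smooth Ck_on_imp_continuous_on by blast

lemma smooth_partial:
  assumes "smooth f" "b \<in> Basis"
  shows "smooth (\<lambda>x. grad f x \<bullet> b)"
  unfolding smooth_def
proof
  fix k
  have "Ck (Suc k) f" using assms smooth_def by blast
  then show "Ck k (\<lambda>x. grad f x \<bullet> b)"
    using assms(2) by (simp add: grad_inner_Basis)
qed

lemma continuous_on_grad:
  assumes "smooth f"
  shows "continuous_on S (grad f)"
proof -
  have "continuous_on S (\<lambda>x. \<Sum>b\<in>Basis. (grad f x \<bullet> b) *\<^sub>R b)"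
    using smooth_partial[OF assms] by (intro continuous_intros continuous_on_smooth)
  then show ?thesis by (simp add: euclidean_representation)
qed

lemma test_function_support:
  assumes "test_function \<Omega> \<phi>"
  obtains K where "compact K" "K \<subseteq> \<Omega>" "\<And>x. x \<notin> K \<Longrightarrow> \<phi> x = 0" "\<And>x. x \<notin> K \<Longrightarrow> grad \<phi> x = 0"
proof -
  define K where "K = closure {x. \<phi> x \<noteq> 0}"
  have K: "compact K" "K \<subseteq> \<Omega>" "smooth \<phi>"
    using assms by (auto simp: test_function_def K_def)
  have 0: "\<phi> x = 0" if "x \<notin> K" for x
    using subsetD[OF closure_subset[of "{x. \<phi> x \<noteq> 0}"], of x] that unfolding K_def by auto
  have "grad \<phi> x = 0" if "x \<notin> K" for x
  proof -
    have "(\<lambda>h. grad \<phi> x \<bullet> h) = (\<lambda>_. 0)"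
      using has_derivative_vanishing_outside[OF smooth_has_derivative_grad[OF K(3)]
          compact_imp_closed[OF K(1)] 0 that] .
    then show ?thesis by (metis inner_eq_zero_iff)
  qed
  then show thesis using that[OF K(1,2) 0] by blast
qed

lemma test_function_partial:
  assumes "test_function \<Omega> \<phi>" "b \<in> Basis"
  shows "test_function \<Omega> (\<lambda>x. grad \<phi> x \<bullet> b)"
proof -
  obtain K where K: "compact K" "K \<subseteq> \<Omega>" "\<And>x. x \<notin> K \<Longrightarrow> grad \<phi> x = 0"
    using test_function_support[OF assms(1)] by metis
  have "{x. grad \<phi> x \<bullet> b \<noteq> 0} \<subseteq> K"
    using K(3) by fastforce
  then have "closure {x. grad \<phi> x \<bullet> b \<noteq> 0} \<subseteq> K"
    using K(1) by (simp add: closure_minimal compact_imp_closed)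
  then have "compact (closure {x. grad \<phi> x \<bullet> b \<noteq> 0})" "closure {x. grad \<phi> x \<bullet> b \<noteq> 0} \<subseteq> \<Omega>"
    using K(1,2) by (auto simp: compact_eq_bounded_closed intro: bounded_subset)
  then show ?thesis
    using smooth_partial assms by (auto simp: test_function_def)
qed

lemma L2_continuous_compact_support:
  fixes f :: "'a::euclidean_space \<Rightarrow> real"
  assumes "open \<Omega>" "continuous_on UNIV f" "compact K" "K \<subseteq> \<Omega>" "\<And>x. x \<notin> K \<Longrightarrow> f x = 0"
  shows "L2 (lebesgue_on \<Omega>) f"
    and "(LINT x|lebesgue_on \<Omega>. (f x)\<^sup>2) = (LINT x|lborel. (f x)\<^sup>2)"
    and "L2 lborel f"
proof -
  have m: "f \<in> borel_measurable borel"
    using assms(2) by (rule borel_measurable_continuous_onI)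
  have i: "integrable lborel (\<lambda>x. (f x)\<^sup>2)"
    using assms by (intro integrable_continuous_compact_support[of _ K] continuous_intros) auto
  show "L2 lborel f"
    using m i by (simp add: L2_def)
  have "f \<in> borel_measurable (lebesgue_on \<Omega>)"
    using m by (simp add: measurable_completion measurable_restrict_space1)
  moreover have "integrable (lebesgue_on \<Omega>) (\<lambda>x. (f x)\<^sup>2) \<longleftrightarrow> integrable lborel (\<lambda>x. (f x)\<^sup>2)"
    and "(LINT x|lebesgue_on \<Omega>. (f x)\<^sup>2) = (LINT x|lborel. (f x)\<^sup>2)"
    using assms m by (intro lebesgue_on_vanishing_outside; auto simp: subset_iff)+
  ultimately show "L2 (lebesgue_on \<Omega>) f" "(LINT x|lebesgue_on \<Omega>. (f x)\<^sup>2) = (LINT x|lborel. (f x)\<^sup>2)"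
    using i by (auto simp: L2_def)
qed

lemma L2_test_function:
  assumes "open \<Omega>" "test_function \<Omega> \<phi>"
  shows "L2 (lebesgue_on \<Omega>) \<phi>" and "L2 (lebesgue_on \<Omega>) (\<lambda>x. norm (grad \<phi> x))"
    and "(LINT x|lebesgue_on \<Omega>. (norm (grad \<phi> x))\<^sup>2) = (LINT x|lborel. (norm (grad \<phi> x))\<^sup>2)"
proof -
  obtain K where K: "compact K" "K \<subseteq> \<Omega>" "\<And>x. x \<notin> K \<Longrightarrow> \<phi> x = 0" "\<And>x. x \<notin> K \<Longrightarrow> grad \<phi> x = 0"
    using test_function_support[OF assms(2)] by metis
  have s: "smooth \<phi>" using assms by (simp add: test_function_def)
  show "L2 (lebesgue_on \<Omega>) \<phi>"
    using L2_continuous_compact_support(1)[OF assms(1) continuous_on_smooth[OF s] K(1,2,3)] .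
  have "continuous_on UNIV (\<lambda>x. norm (grad \<phi> x))"
    by (intro continuous_intros continuous_on_grad s)
  note * = L2_continuous_compact_support[OF assms(1) this K(1,2)]
  show "L2 (lebesgue_on \<Omega>) (\<lambda>x. norm (grad \<phi> x))"
    and "(LINT x|lebesgue_on \<Omega>. (norm (grad \<phi> x))\<^sup>2) = (LINT x|lborel. (norm (grad \<phi> x))\<^sup>2)"
    using *(1,2) K(4) by auto
qed

text \<open>The divergence theorem without boundary term: \<open>F b\<close> is the component of a
  vector field along \<open>b\<close>, and \<open>D b x b\<close> is its partial derivative in that
  direction.\<close>

lemma integral_divergence_eq_0:
  fixes F :: "'a::euclidean_space \<Rightarrow> 'a \<Rightarrow> real"
  assumes "\<And>b x. b \<in> Basis \<Longrightarrow> (F b has_derivative D b x) (at x)"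
    and "\<And>b. b \<in> Basis \<Longrightarrow> continuous_on UNIV (\<lambda>x. D b x b)"
    and "compact K" "\<And>b x. b \<in> Basis \<Longrightarrow> x \<notin> K \<Longrightarrow> F b x = 0"
  shows "(LINT x|lborel. (\<Sum>b\<in>Basis. D b x b)) = 0"
proof -
  have "integrable lborel (\<lambda>x. D b x b)" if "b \<in> Basis" for b
    using that has_derivative_vanishing_outside[OF assms(1) compact_imp_closed[OF assms(3)] assms(4), of b]
    by (intro integrable_continuous_compact_support[OF assms(2,3)]) auto
  then have "(LINT x|lborel. (\<Sum>b\<in>Basis. D b x b)) = (\<Sum>b\<in>Basis. LINT x|lborel. D b x b)"
    by (intro Bochner_Integration.integral_sum)
  also have "\<dots> = 0"
    using integral_directional_derivative_eq_0[OF assms(1) assms(2,3,4)] by (intro sum.neutral) auto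
  finally show ?thesis .
qed

text \<open>Integrate the divergence of \<open>\<phi>\<^sup>2 x / (\<bar>x\<bar>\<^sup>2 + \<delta>)\<close>.\<close>

lemma regularized_hardy_inequality:
  fixes \<phi> :: "'a::euclidean_space \<Rightarrow> real"
  assumes "test_function \<Omega> \<phi>" "DIM('a) \<ge> 3" "\<delta> > 0"
  shows "(LINT x|lborel. (\<phi> x)\<^sup>2 / (x \<bullet> x + \<delta>)) \<le> 4 * (LINT x|lborel. (norm (grad \<phi> x))\<^sup>2)"
proof -
  obtain K where K: "compact K" "\<And>x. x \<notin> K \<Longrightarrow> \<phi> x = 0" "\<And>x. x \<notin> K \<Longrightarrow> grad \<phi> x = 0"
    using test_function_support[OF assms(1)] by metis
  have s: "smooth \<phi>" using assms by (simp add: test_function_def)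
  have pos: "x \<bullet> x + \<delta> > 0" for x :: 'a
    using assms(3) by (simp add: add_nonneg_pos)
  then have nz: "x \<bullet> x + \<delta> \<noteq> 0" for x :: 'a
    by (metis less_irrefl)
  define D where "D b x h = 2 * \<phi> x * (grad \<phi> x \<bullet> h) * ((x \<bullet> b) / (x \<bullet> x + \<delta>))
    + (\<phi> x)\<^sup>2 * ((h \<bullet> b) / (x \<bullet> x + \<delta>) - (x \<bullet> b) * (2 * (x \<bullet> h)) / (x \<bullet> x + \<delta>)\<^sup>2)" for b x h
  have sum_D: "(\<Sum>b\<in>Basis. D b x b) = 2 * \<phi> x * (grad \<phi> x \<bullet> x) / (x \<bullet> x + \<delta>)
    + (\<phi> x)\<^sup>2 * (real DIM('a) / (x \<bullet> x + \<delta>) - 2 * (x \<bullet> x) / (x \<bullet> x + \<delta>)\<^sup>2)" for x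
  proof -
    have sx: "(\<Sum>b\<in>Basis. (x \<bullet> b) * (x \<bullet> b)) = x \<bullet> x"
      and sg: "(\<Sum>b\<in>Basis. (grad \<phi> x \<bullet> b) * (x \<bullet> b)) = grad \<phi> x \<bullet> x"
      by (rule euclidean_inner[symmetric])+
    have "(\<Sum>b\<in>Basis. D b x b) = (\<Sum>b\<in>Basis. 2 * \<phi> x / (x \<bullet> x + \<delta>) * ((grad \<phi> x \<bullet> b) * (x \<bullet> b))
      + ((\<phi> x)\<^sup>2 * (1 / (x \<bullet> x + \<delta>)) - (\<phi> x)\<^sup>2 * 2 / (x \<bullet> x + \<delta>)\<^sup>2 * ((x \<bullet> b) * (x \<bullet> b))))"
      by (intro sum.cong) (auto simp: D_def algebra_simps)
    also have "\<dots> = 2 * \<phi> x / (x \<bullet> x + \<delta>) * (grad \<phi> x \<bullet> x)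
      + (real DIM('a) * ((\<phi> x)\<^sup>2 * (1 / (x \<bullet> x + \<delta>))) - (\<phi> x)\<^sup>2 * 2 / (x \<bullet> x + \<delta>)\<^sup>2 * (x \<bullet> x))"
      unfolding sum.distrib sum_subtractf sum_distrib_left[symmetric] sx sg by simp
    finally show ?thesis by (simp add: algebra_simps)
  qed
  have D: "((\<lambda>x. (\<phi> x)\<^sup>2 * ((x \<bullet> b) / (x \<bullet> x + \<delta>))) has_derivative D b x) (at x)" for b x
  proof -
    have "((\<lambda>x. x \<bullet> x + \<delta>) has_derivative (\<lambda>h. 2 * (x \<bullet> h))) (at x)"
      by (auto intro!: derivative_eq_intros simp: inner_commute)
    from has_derivative_divide'[OF has_derivative_inner_left[OF has_derivative_ident, of b] this nz]
    have q: "((\<lambda>x. (x \<bullet> b) / (x \<bullet> x + \<delta>)) has_derivative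
        (\<lambda>h. (h \<bullet> b) / (x \<bullet> x + \<delta>) - (x \<bullet> b) * (2 * (x \<bullet> h)) / (x \<bullet> x + \<delta>)\<^sup>2)) (at x)"
      by (rule has_derivative_eq_rhs) (simp add: fun_eq_iff nz divide_simps power2_eq_square)
    have p: "((\<lambda>x. (\<phi> x)\<^sup>2) has_derivative (\<lambda>h. 2 * \<phi> x * (grad \<phi> x \<bullet> h))) (at x)"
      by (rule has_derivative_eq_rhs[OF has_derivative_power[OF smooth_has_derivative_grad[OF s]]])
        (simp add: mult_ac)
    show ?thesis
      by (rule has_derivative_eq_rhs[OF has_derivative_mult[OF p q]]) (simp add: D_def fun_eq_iff)
  qed
  have "(LINT x|lborel. (\<Sum>b\<in>Basis. D b x b)) = 0"
  proof (rule integral_divergence_eq_0[OF D _ K(1)])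
    show "continuous_on UNIV (\<lambda>x. D b x b)" for b
      unfolding D_def by (intro continuous_intros continuous_on_smooth continuous_on_grad s) (auto simp: nz)
  qed (use K in auto)
  then have eq0: "(LINT x|lborel. 2 * \<phi> x * (grad \<phi> x \<bullet> x) / (x \<bullet> x + \<delta>)
    + (\<phi> x)\<^sup>2 * (real DIM('a) / (x \<bullet> x + \<delta>) - 2 * (x \<bullet> x) / (x \<bullet> x + \<delta>)\<^sup>2)) = 0"
    unfolding sum_D .
  have i1: "integrable lborel (\<lambda>x. (\<phi> x)\<^sup>2 / (x \<bullet> x + \<delta>))"
    by (intro integrable_continuous_compact_support[OF _ K(1)] continuous_intros continuous_on_smooth s)
      (auto simp: nz K)
  have i2: "integrable lborel (\<lambda>x. (norm (grad \<phi> x))\<^sup>2)"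
    by (intro integrable_continuous_compact_support[OF _ K(1)] continuous_intros continuous_on_grad s)
      (auto simp: K)
  have i3: "integrable lborel (\<lambda>x. 2 * \<phi> x * (grad \<phi> x \<bullet> x) / (x \<bullet> x + \<delta>)
    + (\<phi> x)\<^sup>2 * (real DIM('a) / (x \<bullet> x + \<delta>) - 2 * (x \<bullet> x) / (x \<bullet> x + \<delta>)\<^sup>2))"
    by (intro integrable_continuous_compact_support[OF _ K(1)] continuous_intros continuous_on_grad
        continuous_on_smooth s) (auto simp: K nz)
  \<comment> \<open>Put r = |x|^2 + \<delta>, t = \<phi>^2 / r and y = |\<phi>| |x| / r. The
    divergence is at least 3 t - 2 y^2 up to the mixed term, which Young's inequality bounds by y^2
    / 2 + 2 |grad \<phi>|^2. Since y^2 <= t, at least t / 2 - 2 |grad \<phi>|^2 remains. The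
    resulting factor 4 is Hardy's constant 4 / (N - 2)^2 at N = 3, the largest one among N >=
    3.\<close>
  have "(LINT x|lborel. (\<phi> x)\<^sup>2 / (x \<bullet> x + \<delta>) / 2 - 2 * (norm (grad \<phi> x))\<^sup>2) \<le>
    (LINT x|lborel. 2 * \<phi> x * (grad \<phi> x \<bullet> x) / (x \<bullet> x + \<delta>)
    + (\<phi> x)\<^sup>2 * (real DIM('a) / (x \<bullet> x + \<delta>) - 2 * (x \<bullet> x) / (x \<bullet> x + \<delta>)\<^sup>2))"
  proof (rule integral_mono[OF _ i3])
    show "integrable lborel (\<lambda>x. (\<phi> x)\<^sup>2 / (x \<bullet> x + \<delta>) / 2 - 2 * (norm (grad \<phi> x))\<^sup>2)"
      by (intro Bochner_Integration.integrable_diff integrable_divide_zero integrable_mult_right i1 i2)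
    fix x :: 'a
    define r where "r = x \<bullet> x + \<delta>"
    define t where "t = (\<phi> x)\<^sup>2 / r"
    define y where "y = \<bar>\<phi> x\<bar> * norm x / r"
    have r: "r > 0" "(norm x)\<^sup>2 \<le> r"
      using pos[of x] assms(3) by (simp_all add: r_def power2_norm_eq_inner)
    have y2: "y\<^sup>2 = (\<phi> x)\<^sup>2 * (x \<bullet> x) / r\<^sup>2"
      by (simp add: y_def power_divide power_mult_distrib power2_norm_eq_inner)
    have "t \<ge> 0"
      using r(1) by (simp add: t_def)
    have "y\<^sup>2 \<le> t"
    proof -
      have "y\<^sup>2 = t * ((x \<bullet> x) / r)"
        unfolding y2 t_def by (simp add: power2_eq_square)
      also have "\<dots> \<le> t * 1"
        using \<open>t \<ge> 0\<close> r by (intro mult_left_mono) (simp_all add: power2_norm_eq_inner)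
      finally show ?thesis by simp
    qed
    have "\<bar>2 * \<phi> x * (grad \<phi> x \<bullet> x) / r\<bar> = 2 * \<bar>\<phi> x\<bar> / r * \<bar>grad \<phi> x \<bullet> x\<bar>"
      using r by (simp add: abs_mult)
    also have "\<dots> \<le> 2 * \<bar>\<phi> x\<bar> / r * (norm (grad \<phi> x) * norm x)"
      using r by (intro mult_left_mono Cauchy_Schwarz_ineq2) auto
    also have "\<dots> = 2 * y * norm (grad \<phi> x)"
      by (simp add: y_def)
    also have "\<dots> \<le> y\<^sup>2 / 2 + 2 * (norm (grad \<phi> x))\<^sup>2"
      using zero_le_power2[of "y - 2 * norm (grad \<phi> x)"] by (simp add: power2_diff power_mult_distrib)
    finally have "- (y\<^sup>2 / 2 + 2 * (norm (grad \<phi> x))\<^sup>2) \<le> 2 * \<phi> x * (grad \<phi> x \<bullet> x) / r"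
      by linarith
    moreover have "3 * t - 2 * y\<^sup>2 \<le> (\<phi> x)\<^sup>2 * (real DIM('a) / r - 2 * (x \<bullet> x) / r\<^sup>2)"
    proof -
      have "3 * t \<le> real DIM('a) * t"
        using assms(2) \<open>t \<ge> 0\<close> by (intro mult_right_mono) simp_all
      then show ?thesis
        by (simp add: y2 t_def right_diff_distrib mult_ac)
    qed
    moreover have "t / 2 = (\<phi> x)\<^sup>2 / r / 2" by (simp add: t_def)
    moreover have "c - 2 * g \<le> a + b"
      if "- (z / 2 + 2 * g) \<le> a" "3 * t - 2 * z \<le> b" "t / 2 = c" "z \<le> t" for a b c g z :: real
      using that \<open>t \<ge> 0\<close> by linarith
    ultimately show "(\<phi> x)\<^sup>2 / (x \<bullet> x + \<delta>) / 2 - 2 * (norm (grad \<phi> x))\<^sup>2 \<le>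
        2 * \<phi> x * (grad \<phi> x \<bullet> x) / (x \<bullet> x + \<delta>)
        + (\<phi> x)\<^sup>2 * (real DIM('a) / (x \<bullet> x + \<delta>) - 2 * (x \<bullet> x) / (x \<bullet> x + \<delta>)\<^sup>2)"
      using \<open>y\<^sup>2 \<le> t\<close> unfolding r_def by blast
  qed
  also note eq0
  finally have *: "(LINT x|lborel. (\<phi> x)\<^sup>2 / (x \<bullet> x + \<delta>) / 2 - 2 * (norm (grad \<phi> x))\<^sup>2) \<le> 0" .
  define H where "H = (LINT x|lborel. (\<phi> x)\<^sup>2 / (x \<bullet> x + \<delta>))"
  define G where "G = (LINT x|lborel. (norm (grad \<phi> x))\<^sup>2)"
  have "H / 2 - 2 * G \<le> 0"
    using * unfolding Bochner_Integration.integral_diff[OF integrable_divide_zero[OF i1] integrable_mult_right[OF i2]]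
    by (simp only: integral_divide_zero integral_mult_right_zero H_def G_def)
  then have "H \<le> 4 * G" by simp
  then show ?thesis unfolding H_def G_def .
qed

section \<open>The barrier\<close>

text \<open>Writing |x|^(-\<nu>) as a power of \<open>x \<bullet> x\<close> keeps the
  differentiation rules simple. At the origin \<open>powr\<close> takes the default value 0, so the
  barrier is 0 there instead of infinite; statements about its size have to exclude the
  origin.\<close>

definition barrier :: "real \<Rightarrow> real \<Rightarrow> 'a::euclidean_space \<Rightarrow> real" where
  "barrier \<nu> A x = A * ((x \<bullet> x) powr (- \<nu> / 2) + x \<bullet> x)"

text \<open>The barrier is radial, and its gradient is this scalar times x.\<close>

definition barrier_slope :: "real \<Rightarrow> real \<Rightarrow> 'a::euclidean_space \<Rightarrow> real" where
  "barrier_slope \<nu> A x = A * (2 - \<nu> * (x \<bullet> x) powr (- \<nu> / 2 - 1))"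

lemma has_derivative_inner_powr:
  fixes x :: "'a::euclidean_space"
  assumes "x \<noteq> 0"
  shows "((\<lambda>x. (x \<bullet> x) powr c) has_derivative (\<lambda>k. 2 * c * (x \<bullet> x) powr (c - 1) * (x \<bullet> k))) (at x)"
proof -
  have "((\<lambda>x. x \<bullet> x) has_derivative (\<lambda>k. 2 * (x \<bullet> k))) (at x)"
    by (auto intro!: derivative_eq_intros simp: inner_commute)
  from has_derivative_powr[OF this has_derivative_const[of c]] assms
  show ?thesis
    by (simp add: powr_diff mult_ac)
qed

lemma barrier_has_derivative:
  assumes "x \<noteq> 0"
  shows "(barrier \<nu> A has_derivative (\<lambda>k. barrier_slope \<nu> A x * (x \<bullet> k))) (at x)"
proof -
  have s: "((\<lambda>x. x \<bullet> x) has_derivative (\<lambda>k. 2 * (x \<bullet> k))) (at x)"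
    by (auto intro!: derivative_eq_intros simp: inner_commute)
  show ?thesis
    unfolding barrier_def[abs_def]
    by (rule has_derivative_eq_rhs[OF has_derivative_mult_right[OF
            has_derivative_add[OF has_derivative_inner_powr[OF assms] s]]])
      (simp add: barrier_slope_def fun_eq_iff algebra_simps)
qed

lemma barrier_slope_has_derivative:
  assumes "x \<noteq> 0"
  shows "(barrier_slope \<nu> A has_derivative
    (\<lambda>k. A * \<nu> * (\<nu> + 2) * (x \<bullet> x) powr (- \<nu> / 2 - 2) * (x \<bullet> k))) (at x)"
proof -
  have e: "2 * (- \<nu> / 2 - 1) = - (\<nu> + 2)" "- \<nu> / 2 - 1 - 1 = - \<nu> / 2 - 2" by simp_all
  show ?thesis
    unfolding barrier_slope_def[abs_def]
    by (rule has_derivative_eq_rhs[OF has_derivative_mult_right[OF has_derivative_diff[OF has_derivative_const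
            has_derivative_mult_right[OF has_derivative_inner_powr[OF assms]]]]])
      (simp only: e fun_eq_iff, simp add: algebra_simps)
qed

lemma Ck_on_inner_powr: "Ck_on k (- {0}) (\<lambda>x. (x \<bullet> x) powr c)"
  by (rule Ck_on_powr[OF _ Ck_on_inner_self]) auto

lemma Ck_on_barrier: "Ck_on k (- {0}) (barrier \<nu> A)"
  unfolding barrier_def[abs_def]
  by (intro Ck_on_mult Ck_on_add Ck_on_const Ck_on_inner_powr Ck_on_inner_self) auto

lemma Ck_on_barrier_slope: "Ck_on k (- {0}) (barrier_slope \<nu> A)"
proof -
  have "Ck_on k (- {0}) (\<lambda>x::'a. A * (2 + (- \<nu>) * (x \<bullet> x) powr (- \<nu> / 2 - 1)))"
    by (intro Ck_on_mult Ck_on_add Ck_on_const Ck_on_inner_powr) auto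
  then show ?thesis by (simp add: barrier_slope_def[abs_def])
qed

lemma barrier_0 [simp]: "barrier \<nu> A 0 = 0"
  by (simp add: barrier_def)

text \<open>Outside the unit ball the quadratic term suffices, inside it the singular one. Without
  the quadratic term the barrier would tend to 0 at infinity, and the growth of s^q - s^p could not
  be exploited there.\<close>

lemma barrier_ge:
  assumes "\<nu> \<ge> 0" "A \<ge> 0" "x \<noteq> 0"
  shows "A \<le> barrier \<nu> A x"
proof -
  have "1 \<le> (x \<bullet> x) powr (- \<nu> / 2) + x \<bullet> x"
  proof (cases "x \<bullet> x \<ge> 1")
    case False
    then have "1 powr (- \<nu> / 2) \<le> (x \<bullet> x) powr (- \<nu> / 2)"
      using assms by (intro powr_mono2') auto
    then show ?thesis using inner_ge_zero[of x] by (simp del: inner_ge_zero)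
  qed (simp add: add_increasing)
  then show ?thesis
    using assms(2) mult_left_mono by (fastforce simp: barrier_def)
qed

text \<open>Differentiating a power costs its exponent and one factor 1/|x|. In terms of w this is
  |x| |grad w| <= (2 + \<nu>) w, which turns the logarithmic gradient of w into the Hardy weight
  1/|x|, independently of A.\<close>

lemma barrier_slope_bound:
  assumes "\<nu> \<ge> 0" "A \<ge> 0" "x \<noteq> 0"
  shows "\<bar>barrier_slope \<nu> A x\<bar> * (x \<bullet> x) \<le> (2 + \<nu>) * barrier \<nu> A x"
proof -
  have s: "x \<bullet> x > 0" using assms(3) by simp
  define P where "P = (x \<bullet> x) powr (- \<nu> / 2)"
  have P: "(x \<bullet> x) powr (- \<nu> / 2 - 1) * (x \<bullet> x) = P"
    using s by (simp add: powr_diff P_def)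
  have "P \<ge> 0" by (simp add: P_def)
  have "\<bar>2 - \<nu> * (x \<bullet> x) powr (- \<nu> / 2 - 1)\<bar> \<le> 2 + \<nu> * (x \<bullet> x) powr (- \<nu> / 2 - 1)"
    using assms(1) by (simp add: abs_le_iff)
  then have "\<bar>2 - \<nu> * (x \<bullet> x) powr (- \<nu> / 2 - 1)\<bar> * (x \<bullet> x)
      \<le> (2 + \<nu> * (x \<bullet> x) powr (- \<nu> / 2 - 1)) * (x \<bullet> x)"
    using s by (intro mult_right_mono) auto
  also have "\<dots> = 2 * (x \<bullet> x) + \<nu> * P"
    by (simp only: distrib_right mult.assoc P)
  also have "\<dots> \<le> (2 + \<nu>) * (P + x \<bullet> x)"
    using assms(1) s \<open>P \<ge> 0\<close> by (simp add: algebra_simps)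
  finally have "A * (\<bar>2 - \<nu> * (x \<bullet> x) powr (- \<nu> / 2 - 1)\<bar> * (x \<bullet> x)) \<le> A * ((2 + \<nu>) * (P + x \<bullet> x))"
    using assms(2) by (rule mult_left_mono)
  then show ?thesis
    using assms(2) by (simp add: barrier_def barrier_slope_def abs_mult P_def mult_ac)
qed

lemma barrier_blow_up:
  assumes "\<nu> > 0" "A > 0"
  obtains \<delta> where "\<delta> > 0" "\<And>x. x \<noteq> 0 \<Longrightarrow> x \<bullet> x < \<delta> \<Longrightarrow> M < barrier \<nu> A x"
proof
  \<comment> \<open>The singular term alone is made to exceed |M| + 1: the squared radius s below
    solves A s^(-\<nu>/2) = |M| + 1.\<close>
  define L where "L = (\<bar>M\<bar> + 1) / A"
  have L: "L > 0" using assms by (simp add: L_def add_nonneg_pos)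
  show "L powr (- 2 / \<nu>) > 0" using L by simp
  fix x :: 'a
  assume x: "x \<noteq> 0" "x \<bullet> x < L powr (- 2 / \<nu>)"
  have "(L powr (- 2 / \<nu>)) powr (- \<nu> / 2) < (x \<bullet> x) powr (- \<nu> / 2)"
    using x assms by (intro powr_less_mono2_neg) auto
  then have "L < (x \<bullet> x) powr (- \<nu> / 2)"
    using assms L by (simp add: powr_powr)
  also have "\<dots> \<le> (x \<bullet> x) powr (- \<nu> / 2) + x \<bullet> x" by simp
  finally have "A * L < barrier \<nu> A x"
    using assms(2) by (simp add: barrier_def)
  then show "M < barrier \<nu> A x"
    using assms(2) by (simp add: L_def)
qed

text \<open>The calculus rules give regularity off the origin, where the barrier is smooth, and near
  the origin the function is constant. The two open sets cover the space, and regularity is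
  local.\<close>

lemma Ck_vanishing_near_0:
  fixes f :: "'a::euclidean_space \<Rightarrow> real"
  assumes "Ck_on k (- {0}) f" "\<delta> > 0" "\<And>x. x \<bullet> x < \<delta> \<Longrightarrow> f x = 0"
  shows "Ck k f"
proof -
  define U :: "'a set" where "U = {x. x \<bullet> x < \<delta>}"
  have U: "open U" unfolding U_def by (intro open_Collect_less continuous_intros)
  have "Ck_on k U f"
    by (rule Ck_on_cong[OF U _ Ck_on_const[OF U, of k 0]]) (simp add: U_def assms(3))
  then have "Ck_on k (- {0} \<union> U) f"
    using U assms(1) by (intro Ck_on_Un) auto
  moreover have "- {0} \<union> U = UNIV" using assms(2) by (auto simp: U_def)
  ultimately show ?thesis using Ck_on_UNIV by metis
qed

section \<open>Pointwise lower bound for the absorption term\<close>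

lemma powr_le_add_powr:
  fixes s :: real
  assumes "s > 0" "1 \<le> p" "p \<le> q"
  shows "s powr p \<le> s + s powr q"
proof (cases "s \<le> 1")
  case True
  then have "s powr p \<le> s powr 1" using assms by (intro powr_mono') auto
  then show ?thesis using assms by (simp add: add_increasing2)
next
  case False
  then have "s powr p \<le> s powr q" using assms by (intro powr_mono) auto
  then show ?thesis using assms by simp
qed

text \<open>If w <= u, then u^q - u^p >= (\<beta> + 1) u: the part \<beta> u pays for \<beta> A u
  because A <= w, and the spare u yields u w h. If u < w, then u^q - u^p >= - u, so at most (1 +
  \<beta>) u w h is lost; there w h <= max (\<phi> - w) 0 <= |u - \<phi>|, which makes the loss an
  error term linear in the distance of u and \<phi>.\<close>

lemma absorption_lower_bound:
  fixes u w h \<phi> :: real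
  assumes "0 < u" "A \<le> w" "0 < A" "0 \<le> h" "w * h \<le> max (\<phi> - w) 0" "0 \<le> \<beta>" "1 \<le> p" "p \<le> q"
    and large: "\<And>s. A \<le> s \<Longrightarrow> \<beta> + 1 \<le> s powr (q - 1) - s powr (p - 1)"
  shows "(if w \<le> u then u * (w * h) else 0) - (1 + \<beta>) * (\<bar>u\<bar> * \<bar>u - \<phi>\<bar>)
    \<le> ((u powr q - u powr p) * w - \<beta> * A * u) * h"
proof (cases "w \<le> u")
  case True
  have "u powr q - u powr p = u * (u powr (q - 1) - u powr (p - 1))"
    using assms(1) by (simp add: powr_diff right_diff_distrib)
  also have "\<dots> \<ge> u * (\<beta> + 1)"
    using assms True by (intro mult_left_mono large) auto
  finally have "u * (\<beta> + 1) * w \<le> (u powr q - u powr p) * w"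
    using assms by (intro mult_right_mono) auto
  moreover have "\<beta> * A * u \<le> \<beta> * w * u"
    using assms by (intro mult_right_mono mult_left_mono) auto
  ultimately have "u * w \<le> (u powr q - u powr p) * w - \<beta> * A * u"
    by (simp add: algebra_simps)
  then have "u * w * h \<le> ((u powr q - u powr p) * w - \<beta> * A * u) * h"
    using assms(4) by (rule mult_right_mono)
  moreover have "0 \<le> (1 + \<beta>) * (\<bar>u\<bar> * \<bar>u - \<phi>\<bar>)"
    using assms by simp
  ultimately show ?thesis using True by (simp add: mult.assoc)
next
  case False
  have "w * h \<le> \<bar>u - \<phi>\<bar>" using assms(5) False by (auto simp: max_def split: if_splits)
  have "- u * w \<le> (u powr q - u powr p) * w"
    using powr_le_add_powr[OF assms(1,7,8)] assms by (intro mult_right_mono) auto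
  moreover have "\<beta> * A * u \<le> \<beta> * w * u"
    using assms by (intro mult_right_mono mult_left_mono) auto
  ultimately have "- ((1 + \<beta>) * u * w) \<le> (u powr q - u powr p) * w - \<beta> * A * u"
    by (simp add: algebra_simps)
  then have "- ((1 + \<beta>) * u * w) * h \<le> ((u powr q - u powr p) * w - \<beta> * A * u) * h"
    using assms(4) by (rule mult_right_mono)
  moreover have "(1 + \<beta>) * u * (w * h) \<le> (1 + \<beta>) * u * \<bar>u - \<phi>\<bar>"
    using assms \<open>w * h \<le> \<bar>u - \<phi>\<bar>\<close> by (intro mult_left_mono) auto
  ultimately show ?thesis using False assms(1) by (simp add: mult.assoc)
qed

lemma borel_measurable_barrier:
  fixes S :: "'a::euclidean_space set"
  shows "barrier \<nu> A \<in> borel_measurable (lebesgue_on S)"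
proof -
  have "(barrier \<nu> A :: 'a \<Rightarrow> real) \<in> borel_measurable borel"
    unfolding barrier_def[abs_def] by measurable
  then show ?thesis by (simp add: measurable_completion measurable_restrict_space1)
qed

lemma borel_measurable_flat: "flat n \<in> borel_measurable borel"
  by (intro borel_measurable_continuous_onI
      DERIV_continuous_on[OF has_field_derivative_at_within[OF flat_has_real_derivative]])

section \<open>Testing with the truncated quotient\<close>

text \<open>One approximant \<phi> is fixed. The equation \<open>indicial\<close> says that
  |x|^(-\<nu>) solves -Lap v = \<mu> v / |x|^2 off the origin. The number \<delta> is a squared
  radius and plays two roles: \<phi> lies below the barrier for x \<bullet> x < \<delta>, and
  \<delta> regularises the Hardy weight. Where x \<bullet> x >= \<delta>, one has x \<bullet> x +
  \<delta> <= 2 (x \<bullet> x), so the regularisation costs only a fixed factor.\<close>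

locale barrier_comparison =
  fixes \<nu> \<mu> A \<beta> \<delta> :: real and \<Omega> :: "'a::euclidean_space set" and \<phi> :: "'a \<Rightarrow> real"
  assumes \<nu>: "\<nu> > 0" and A: "A > 0" and \<delta>: "\<delta> > 0"
    and indicial: "\<nu> * (real DIM('a) - 2 - \<nu>) = \<mu>"
    and \<beta>_eq: "\<beta> = \<mu> + 2 * real DIM('a)"
    and test: "test_function \<Omega> \<phi>"
    and below: "\<And>x. x \<noteq> 0 \<Longrightarrow> x \<bullet> x < \<delta> \<Longrightarrow> \<phi> x < barrier \<nu> A x"
begin

abbreviation "w \<equiv> barrier \<nu> A :: 'a \<Rightarrow> real"
abbreviation "m \<equiv> barrier_slope \<nu> A :: 'a \<Rightarrow> real"

definition "h x = flat 0 (\<phi> x / w x - 1)"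
text \<open>The derivative of the cut-off evaluated at the quotient, not a derivative in x.\<close>

definition "h' x = flat 2 (\<phi> x / w x - 1)"
definition "\<psi> x = w x * h x"
text \<open>The counterpart of \<open>\<psi>\<close> in Picone's identity: the equation for u is
  tested with \<open>\<psi>\<close>, the one for the barrier with \<open>\<eta>\<close>. They are
  linked by \<open>\<phi> x * \<psi> x = w x * \<eta> x\<close>, which matches the two Hardy
  terms.\<close>

definition "\<eta> x = \<phi> x * h x"
text \<open>The gradient of the quotient \<phi> / w.\<close>

definition "direction x = (1 / w x) *\<^sub>R grad \<phi> x - (\<phi> x * m x / (w x)\<^sup>2) *\<^sub>R x"

lemma smooth_\<phi>: "smooth \<phi>"
  using test by (simp add: test_function_def)

lemma w_pos: "x \<noteq> 0 \<Longrightarrow> w x > 0"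
  using barrier_ge[of \<nu> A x] \<nu> A by simp

lemma h_nonneg: "h x \<ge> 0" and h'_nonneg: "h' x \<ge> 0" and h'_le: "h' x \<le> 2"
  by (simp_all add: h_def h'_def flat_nonneg flat_2_le)

lemma h_eq_0: "\<phi> x \<le> w x \<Longrightarrow> h x = 0" and h'_eq_0: "\<phi> x \<le> w x \<Longrightarrow> h' x = 0"
  by (cases "x = 0"; simp add: h_def h'_def w_pos)+

lemma near_0:
  assumes "x \<bullet> x < \<delta>"
  shows "h x = 0" "h' x = 0"
proof -
  \<comment> \<open>At the origin \<open>below\<close> gives nothing, but \<open>w 0 = 0\<close>
    makes the quotient 0 by the convention for division, so the argument of \<open>flat\<close> is
    -1 and both functions vanish there too.\<close>
  have "\<phi> x \<le> w x \<or> x = 0" using below assms less_imp_le by blast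
  then show "h x = 0" "h' x = 0"
    using h_eq_0 h'_eq_0 by (auto simp: h_def h'_def)
qed

lemma h_le: "x \<noteq> 0 \<Longrightarrow> w x * h x \<le> max (\<phi> x - w x) 0"
proof -
  assume x: "x \<noteq> 0"
  have "w x * h x \<le> w x * max (\<phi> x / w x - 1) 0"
    unfolding h_def using w_pos[OF x] by (intro mult_left_mono flat_0_le) simp
  also have "\<dots> = max (\<phi> x - w x) 0"
    using w_pos[OF x] by (simp add: max_def field_simps)
  finally show ?thesis .
qed

lemma h_outside: "\<phi> x = 0 \<Longrightarrow> h x = 0"
  by (simp add: h_def)

lemma Ck_on_h: "Ck_on k (- {0}) h"
proof -
  have "Ck_on k (- {0}) (\<lambda>x. flat 0 (\<phi> x * w x powr (- 1) + (- 1)))"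
    using w_pos
    by (intro Ck_on_flat Ck_on_add Ck_on_mult Ck_on_const Ck_on_powr Ck_on_barrier test_function_Ck_on[OF test]) auto
  then show ?thesis
    by (rule Ck_on_cong[rotated 2]) (auto simp: h_def powr_minus_divide w_pos dest: w_pos)
qed

lemma Ck_on_\<eta>: "Ck_on k (- {0}) \<eta>"
  unfolding \<eta>_def[abs_def] by (intro Ck_on_mult Ck_on_h test_function_Ck_on[OF test]) auto

lemma Ck_on_\<psi>: "Ck_on k (- {0}) \<psi>"
  unfolding \<psi>_def[abs_def] by (intro Ck_on_mult Ck_on_h Ck_on_barrier) auto

text \<open>The factor \<open>h\<close> vanishes near the origin and wherever \<phi> does. So
  anything that vanishes with \<open>h\<close> inherits the support of \<phi>, and its regularity
  has to be checked off the origin only.\<close>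

lemma test_functionI:
  assumes "\<And>k. Ck_on k (- {0}) f" "\<And>x. h x = 0 \<Longrightarrow> f x = 0"
  shows "test_function \<Omega> f"
proof -
  have "Ck k f" for k
    using assms near_0 by (intro Ck_vanishing_near_0[OF _ \<delta>]) auto
  then have "smooth f" by (simp add: smooth_def)
  moreover have "closure {x. f x \<noteq> 0} \<subseteq> closure {x. \<phi> x \<noteq> 0}"
    using assms(2) h_outside by (intro closure_mono) auto
  moreover have "compact (closure {x. \<phi> x \<noteq> 0})" "closure {x. \<phi> x \<noteq> 0} \<subseteq> \<Omega>"
    using test by (auto simp: test_function_def)
  ultimately show ?thesis
    unfolding test_function_def by (meson closed_closure closed_subset compact_eq_bounded_closed bounded_subset order_trans)
qed

lemma test_function_h: "test_function \<Omega> h"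
  by (rule test_functionI[OF Ck_on_h])

lemma test_function_\<psi>: "test_function \<Omega> \<psi>"
  by (rule test_functionI[OF Ck_on_\<psi>]) (simp add: \<psi>_def)

lemma test_function_\<eta>: "test_function \<Omega> \<eta>"
  by (rule test_functionI[OF Ck_on_\<eta>]) (simp add: \<eta>_def)

lemma grad_near_0:
  assumes "x \<bullet> x < \<delta>"
  shows "grad \<psi> x = 0" "grad \<eta> x = 0"
proof -
  have U: "closed {x::'a. \<delta> \<le> x \<bullet> x}" by (intro closed_Collect_le continuous_intros)
  have "grad f x = 0" if f: "test_function \<Omega> f" "\<And>x. h x = 0 \<Longrightarrow> f x = 0" for f
  proof -
    have "smooth f" using f(1) by (simp add: test_function_def)
    moreover have "f y = 0" if "y \<notin> {x. \<delta> \<le> x \<bullet> x}" for y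
      using that near_0 f(2)[of y] by auto
    moreover have "x \<notin> {x. \<delta> \<le> x \<bullet> x}" using assms by simp
    ultimately have "(\<lambda>k. grad f x \<bullet> k) = (\<lambda>_. 0)"
      using has_derivative_vanishing_outside[OF smooth_has_derivative_grad U] by blast
    then show ?thesis by (metis inner_eq_zero_iff)
  qed
  then show "grad \<psi> x = 0" "grad \<eta> x = 0"
    using test_function_\<psi> test_function_\<eta> by (simp_all add: \<psi>_def \<eta>_def)
qed

section \<open>Gradients of the test functions and Picone's identity\<close>

lemma h_has_derivative:
  assumes "x \<noteq> 0"
  shows "(h has_derivative (\<lambda>k. h' x * (direction x \<bullet> k))) (at x)"
proof -
  have nz: "w x \<noteq> 0" using w_pos[OF assms] by simp
  have q: "((\<lambda>x. \<phi> x / w x - 1) has_derivative (\<lambda>k. direction x \<bullet> k)) (at x)"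
    by (rule has_derivative_eq_rhs[OF has_derivative_diff[OF has_derivative_divide'[OF
            smooth_has_derivative_grad[OF smooth_\<phi>] barrier_has_derivative[OF assms] nz] has_derivative_const]])
      (simp add: direction_def fun_eq_iff inner_diff_left nz divide_simps power2_eq_square)
  have "(flat 0 has_derivative (\<lambda>k. h' x * k)) (at (\<phi> x / w x - 1))"
    using flat_has_real_derivative[of 0 "\<phi> x / w x - 1"] by (simp add: has_field_derivative_def h'_def numeral_2_eq_2)
  from has_derivative_compose[OF q this] show ?thesis
    by (simp add: h_def[abs_def])
qed

lemma grad_\<psi>:
  assumes "x \<noteq> 0"
  shows "grad \<psi> x = (h x * m x) *\<^sub>R x + (w x * h' x) *\<^sub>R direction x"
  unfolding \<psi>_def[abs_def]
  by (intro grad_eqI has_derivative_eq_rhs[OF has_derivative_mult[OF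
          barrier_has_derivative[OF assms] h_has_derivative[OF assms]]])
    (simp add: fun_eq_iff inner_add_left)

lemma grad_\<eta>:
  assumes "x \<noteq> 0"
  shows "grad \<eta> x = h x *\<^sub>R grad \<phi> x + (\<phi> x * h' x) *\<^sub>R direction x"
  unfolding \<eta>_def[abs_def]
  by (intro grad_eqI has_derivative_eq_rhs[OF has_derivative_mult[OF
          smooth_has_derivative_grad[OF smooth_\<phi>] h_has_derivative[OF assms]]])
    (simp add: fun_eq_iff inner_add_left)

text \<open>Picone's identity: the difference of the two sides is \<open>w\<^sup>2 h' \<bar>\<nabla>(\<phi> / w)\<bar>\<^sup>2\<close>.\<close>

lemma picone: "m x * (x \<bullet> grad \<eta> x) \<le> grad \<phi> x \<bullet> grad \<psi> x"
proof (cases "x = 0")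
  case True
  then show ?thesis using grad_near_0(1)[of 0] \<delta> by simp
next
  case False
  have nz: "w x \<noteq> 0" using w_pos[OF False] by simp
  have "grad \<phi> x \<bullet> grad \<psi> x - m x * (x \<bullet> grad \<eta> x)
      = h' x * ((w x *\<^sub>R grad \<phi> x - (\<phi> x * m x) *\<^sub>R x) \<bullet> direction x)"
    by (simp add: grad_\<psi>[OF False] grad_\<eta>[OF False] inner_add_right inner_diff_left algebra_simps inner_commute)
  also have "w x *\<^sub>R grad \<phi> x - (\<phi> x * m x) *\<^sub>R x = (w x)\<^sup>2 *\<^sub>R direction x"
    using nz by (simp add: direction_def scaleR_diff_right power2_eq_square)
  finally have "grad \<phi> x \<bullet> grad \<psi> x - m x * (x \<bullet> grad \<eta> x) = h' x * (w x)\<^sup>2 * (direction x \<bullet> direction x)"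
    by simp
  then show ?thesis using h'_nonneg[of x] by (smt (verit) inner_ge_zero mult_nonneg_nonneg zero_le_power2)
qed

text \<open>Only the set where x \<bullet> x >= \<delta> and \<phi> > w matters. There h <= \<phi> /
  w and h' <= 2, so \<phi> |grad w| / w appears 1 + 2 = 3 times; it is at most (2 + \<nu>) \<phi> /
  |x|, and 1/|x| <= 2 / sqrt (x \<bullet> x + \<delta>) makes the factor 6. The right-hand side is
  controlled by Hardy's inequality with constants free of \<delta> and A.\<close>

lemma norm_grad_\<psi>_le:
  "norm (grad \<psi> x) \<le> 2 * norm (grad \<phi> x) + 6 * (2 + \<nu>) * (\<bar>\<phi> x\<bar> / sqrt (x \<bullet> x + \<delta>))"
proof (cases "x \<bullet> x < \<delta> \<or> \<phi> x \<le> w x")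
  case True
  have "grad \<psi> x = 0"
  proof (cases "x \<bullet> x < \<delta>")
    case False
    then have "x \<noteq> 0" "\<phi> x \<le> w x" using True \<delta> by auto
    then show ?thesis by (simp add: grad_\<psi> h_eq_0 h'_eq_0)
  qed (rule grad_near_0(1))
  moreover have "0 \<le> 2 * norm (grad \<phi> x) + 6 * (2 + \<nu>) * (\<bar>\<phi> x\<bar> / sqrt (x \<bullet> x + \<delta>))"
    using \<nu> \<delta> by (intro add_nonneg_nonneg mult_nonneg_nonneg divide_nonneg_nonneg) auto
  ultimately show ?thesis by simp
next
  case False
  then have x: "x \<noteq> 0" "x \<bullet> x \<ge> \<delta>" "\<phi> x > w x" using \<delta> by auto
  have wp: "w x > 0" using w_pos[OF x(1)] .
  have m: "\<bar>m x\<bar> * norm x / w x \<le> (2 + \<nu>) / norm x"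
  proof -
    have "\<bar>m x\<bar> * norm x * norm x \<le> (2 + \<nu>) * w x"
      using barrier_slope_bound[of \<nu> A x] \<nu> A x(1)
      by (simp add: mult.assoc flip: power2_norm_eq_inner power2_eq_square)
    then show ?thesis using x(1) wp by (simp add: field_simps)
  qed
  have h: "h x \<le> \<phi> x / w x"
    using h_le[OF x(1)] x(3) wp by (simp add: field_simps)
  have "norm (grad \<psi> x) \<le> h x * \<bar>m x\<bar> * norm x + w x * h' x * norm (direction x)"
    unfolding grad_\<psi>[OF x(1)]
    using h_nonneg[of x] h'_nonneg[of x] wp
    by (intro norm_triangle_le) (simp add: abs_mult)
  also have "h x * \<bar>m x\<bar> * norm x \<le> \<phi> x / w x * \<bar>m x\<bar> * norm x"
    using h by (intro mult_right_mono) auto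
  also have "w x * h' x * norm (direction x) \<le> w x * 2 * (norm (grad \<phi> x) / w x + \<phi> x * \<bar>m x\<bar> / (w x)\<^sup>2 * norm x)"
  proof (intro mult_mono mult_left_mono h'_le)
    show "norm (direction x) \<le> norm (grad \<phi> x) / w x + \<phi> x * \<bar>m x\<bar> / (w x)\<^sup>2 * norm x"
      unfolding direction_def using wp x(3)
      by (intro norm_triangle_le_diff) (simp add: abs_mult)
  qed (use wp h'_nonneg in auto)
  also have "\<phi> x / w x * \<bar>m x\<bar> * norm x + w x * 2 * (norm (grad \<phi> x) / w x + \<phi> x * \<bar>m x\<bar> / (w x)\<^sup>2 * norm x)
      = 2 * norm (grad \<phi> x) + 3 * \<phi> x * (\<bar>m x\<bar> * norm x / w x)"
    using wp by (simp add: field_simps power2_eq_square)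
  also have "3 * \<phi> x * (\<bar>m x\<bar> * norm x / w x) \<le> 3 * \<phi> x * ((2 + \<nu>) / norm x)"
    using m x(3) wp by (intro mult_left_mono) auto
  also have "3 * \<phi> x * ((2 + \<nu>) / norm x) \<le> 3 * \<phi> x * ((2 + \<nu>) * (2 / sqrt (x \<bullet> x + \<delta>)))"
  proof -
    have "sqrt (x \<bullet> x + \<delta>) \<le> sqrt (2\<^sup>2 * (x \<bullet> x))"
      using x(2) \<delta> by (intro real_sqrt_le_mono) simp
    also have "\<dots> = 2 * norm x"
      by (simp add: real_sqrt_mult norm_eq_sqrt_inner)
    finally have "1 / norm x \<le> 2 / sqrt (x \<bullet> x + \<delta>)"
      using x \<delta> by (simp add: field_simps add_pos_pos)
    then have "(2 + \<nu>) * (1 / norm x) \<le> (2 + \<nu>) * (2 / sqrt (x \<bullet> x + \<delta>))"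
      using \<nu> by (intro mult_left_mono) auto
    then show ?thesis using x(3) wp by (intro mult_left_mono) auto
  qed
  finally show ?thesis
    using x(3) wp by (simp add: mult_ac)
qed

section \<open>Divergence of \<open>\<eta>\<close> times the gradient of the barrier\<close>

lemma grad_flux:
  assumes "x \<noteq> 0"
  shows "grad (\<lambda>x. \<eta> x * m x * (x \<bullet> b)) x \<bullet> b
    = m x * ((x \<bullet> b) * (grad \<eta> x \<bullet> b))
      + \<eta> x * (A * \<nu> * (\<nu> + 2) * (x \<bullet> x) powr (- \<nu> / 2 - 2)) * ((x \<bullet> b) * (x \<bullet> b))
      + \<eta> x * m x * (b \<bullet> b)"
proof -
  define c where "c = A * \<nu> * (\<nu> + 2) * (x \<bullet> x) powr (- \<nu> / 2 - 2)"
  have s: "smooth \<eta>" using test_function_\<eta> by (simp add: test_function_def)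
  have "grad (\<lambda>x. \<eta> x * m x * (x \<bullet> b)) x =
      (m x * (x \<bullet> b)) *\<^sub>R grad \<eta> x + (\<eta> x * c * (x \<bullet> b)) *\<^sub>R x + (\<eta> x * m x) *\<^sub>R b"
    by (intro grad_eqI has_derivative_eq_rhs[OF has_derivative_mult[OF has_derivative_mult[OF
          smooth_has_derivative_grad[OF s] barrier_slope_has_derivative[OF assms]]
          has_derivative_inner_left[OF has_derivative_ident]]])
      (simp add: fun_eq_iff inner_add_left c_def algebra_simps inner_commute)
  then show ?thesis
    by (simp add: inner_add_left c_def algebra_simps)
qed

text \<open>The field is \<eta> grad w, with divergence grad w . grad \<eta> + \<eta> Lap w. By the
  indicial equation Lap |x|^(-\<nu>) = - \<mu> |x|^(-\<nu>-2), and Lap |x|^2 = 2 N. Completing the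
  first term to - \<mu> w / |x|^2 costs another \<mu> A, so the constant left over is \<beta> A.
  Finally \<eta> w = \<phi> \<psi>.\<close>

lemma divergence_flux:
  "(\<Sum>b\<in>Basis. grad (\<lambda>x. \<eta> x * m x * (x \<bullet> b)) x \<bullet> b)
    = m x * (x \<bullet> grad \<eta> x) - \<mu> * (\<phi> x * \<psi> x / (x \<bullet> x)) + \<beta> * A * (\<phi> x * h x)"
  if "x \<noteq> 0"
proof -
  have s: "x \<bullet> x > 0" using that by simp
  define P where "P = (x \<bullet> x) powr (- \<nu> / 2)"
  have P1: "(x \<bullet> x) powr (- \<nu> / 2 - 1) = P / (x \<bullet> x)"
    using s by (simp add: powr_diff P_def)
  have P2: "(x \<bullet> x) powr (- \<nu> / 2 - 2) = P / (x \<bullet> x)\<^sup>2"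
    using s by (simp add: powr_diff P_def)
  have sums: "(\<Sum>b\<in>Basis. (x \<bullet> b) * (grad \<eta> x \<bullet> b)) = x \<bullet> grad \<eta> x"
    "(\<Sum>b\<in>Basis. (x \<bullet> b) * (x \<bullet> b)) = x \<bullet> x" "(\<Sum>b\<in>(Basis::'a set). b \<bullet> b) = real DIM('a)"
    by (rule euclidean_inner[symmetric])+ simp
  have "(\<Sum>b\<in>Basis. grad (\<lambda>x. \<eta> x * m x * (x \<bullet> b)) x \<bullet> b)
    = m x * (x \<bullet> grad \<eta> x) + \<eta> x * (A * \<nu> * (\<nu> + 2) * (x \<bullet> x) powr (- \<nu> / 2 - 2)) * (x \<bullet> x)
      + \<eta> x * m x * real DIM('a)"
    unfolding grad_flux[OF that] sum.distrib sum_distrib_left[symmetric] sums ..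
  also have "\<dots> = m x * (x \<bullet> grad \<eta> x)
    + \<eta> x * (A * (\<nu> * (\<nu> + 2) - real DIM('a) * \<nu>) * (P / (x \<bullet> x)) + 2 * A * real DIM('a))"
    unfolding barrier_slope_def P1 P2 using s by (simp add: power2_eq_square algebra_simps)
  also have "\<nu> * (\<nu> + 2) - real DIM('a) * \<nu> = - \<mu>"
    unfolding indicial[symmetric] by (simp add: algebra_simps)
  also have "\<eta> x * (A * (- \<mu>) * (P / (x \<bullet> x)) + 2 * A * real DIM('a))
      = - \<mu> * (\<eta> x * w x / (x \<bullet> x)) + \<beta> * A * \<eta> x"
    unfolding barrier_def P_def[symmetric] \<beta>_eq using s by (simp add: field_simps)
  moreover have "\<eta> x = \<phi> x * h x" by (rule \<eta>_def)
  ultimately show ?thesis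
    by (simp add: \<psi>_def mult_ac)
qed

lemma test_function_flux: "test_function \<Omega> (\<lambda>x. \<eta> x * m x * (x \<bullet> b))"
  by (intro test_functionI Ck_on_mult Ck_on_\<eta> Ck_on_barrier_slope Ck_on_inner) (auto simp: \<eta>_def)

text \<open>Since \<open>\<psi>\<close> vanishes near the origin, the Hardy weight can be absorbed
  into the test function. This makes the Hardy terms continuous or integrable although the weight
  itself is singular.\<close>

lemma test_function_\<psi>_hardy: "test_function \<Omega> (\<lambda>x. \<psi> x / (x \<bullet> x))"
proof (rule test_functionI)
  fix k
  have "Ck_on k (- {0}) (\<lambda>x. \<psi> x * (x \<bullet> x) powr (- 1))"
    by (intro Ck_on_mult Ck_on_\<psi> Ck_on_inner_powr) auto
  then show "Ck_on k (- {0}) (\<lambda>x. \<psi> x / (x \<bullet> x))"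
    by (simp add: powr_minus_divide)
qed (simp add: \<psi>_def)

text \<open>The divergence of \<eta> grad w integrates to 0, and Picone's identity bounds it above
  by the integrand stated here. In effect the barrier equation is tested with \<open>\<eta>\<close>,
  and grad w . grad \<eta> is then replaced by grad \<phi> . grad \<psi>.\<close>

lemma integrated_picone:
  assumes "open \<Omega>"
  shows "integrable (lebesgue_on \<Omega>) (\<lambda>x. grad \<phi> x \<bullet> grad \<psi> x - \<mu> * (\<phi> x * \<psi> x / (x \<bullet> x)) + \<beta> * A * (\<phi> x * h x))"
    and "0 \<le> (LINT x|lebesgue_on \<Omega>. grad \<phi> x \<bullet> grad \<psi> x - \<mu> * (\<phi> x * \<psi> x / (x \<bullet> x)) + \<beta> * A * (\<phi> x * h x))"
proof -
  define F where "F b x = \<eta> x * m x * (x \<bullet> b)" for b x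
  have sF: "smooth (F b)" for b
    using test_function_flux unfolding F_def[abs_def] by (simp add: test_function_def)
  obtain K where K: "compact K" "K \<subseteq> \<Omega>" "\<And>x. x \<notin> K \<Longrightarrow> \<phi> x = 0" "\<And>x. x \<notin> K \<Longrightarrow> grad \<phi> x = 0"
    using test_function_support[OF test] by metis
  have F0: "F b x = 0" if "x \<notin> K" for b x
    using K(3)[OF that] by (simp add: F_def \<eta>_def)
  have D0: "grad (F b) x = 0" if "x \<notin> K" for b x
  proof -
    have "(\<lambda>k. grad (F b) x \<bullet> k) = (\<lambda>_. 0)"
      by (rule has_derivative_vanishing_outside[OF smooth_has_derivative_grad[OF sF]
            compact_imp_closed[OF K(1)] F0 that])
    then show ?thesis by (metis inner_eq_zero_iff)
  qed
  have div0: "(LINT x|lborel. (\<Sum>b\<in>Basis. grad (F b) x \<bullet> b)) = 0"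
    by (rule integral_divergence_eq_0[where F = F and K = K])
      (auto intro!: smooth_has_derivative_grad sF continuous_intros continuous_on_grad K(1) F0)
  have "integrable lborel (\<lambda>x. grad (F b) x \<bullet> b)" for b
    using D0 by (intro integrable_continuous_compact_support[OF _ K(1)] continuous_intros continuous_on_grad sF) auto
  then have div_int: "integrable lborel (\<lambda>x. \<Sum>b\<in>Basis. grad (F b) x \<bullet> b)"
    by (intro Bochner_Integration.integrable_sum)
  let ?H = "\<lambda>x. grad \<phi> x \<bullet> grad \<psi> x - \<mu> * (\<phi> x * \<psi> x / (x \<bullet> x)) + \<beta> * A * (\<phi> x * h x)"
  have le: "(\<Sum>b\<in>Basis. grad (F b) x \<bullet> b) \<le> ?H x" if "x \<noteq> 0" for x
    unfolding F_def[abs_def] divergence_flux[OF that] using picone[of x] by simp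
  have "continuous_on UNIV (\<lambda>x. grad \<phi> x \<bullet> grad \<psi> x - \<mu> * (\<phi> x * (\<psi> x / (x \<bullet> x))) + \<beta> * A * (\<phi> x * h x))"
    using test_function_\<psi> test_function_\<psi>_hardy test_function_h smooth_\<phi>
    by (intro continuous_on_add continuous_on_diff continuous_on_mult continuous_on_const
        continuous_on_inner continuous_on_grad continuous_on_smooth) (auto simp: test_function_def)
  then have c: "continuous_on UNIV ?H" by simp
  have H0: "?H x = 0" if "x \<notin> K" for x
    using K(3,4)[OF that] by simp
  have i: "integrable lborel ?H"
    by (rule integrable_continuous_compact_support[OF c K(1) H0])
  have meas: "?H \<in> borel_measurable borel" using c by (rule borel_measurable_continuous_onI)
  have \<Omega>: "\<Omega> \<in> sets lebesgue" using assms by simp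
  have out: "?H x = 0" if "x \<notin> \<Omega>" for x using H0[of x] K(2) that by blast
  show "integrable (lebesgue_on \<Omega>) ?H"
    using lebesgue_on_vanishing_outside(1)[OF \<Omega> meas out] i by simp
  have "AE x in lborel. (\<Sum>b\<in>Basis. grad (F b) x \<bullet> b) \<le> ?H x"
    using AE_lborel_singleton[of "0::'a"] by eventually_elim (rule le)
  then have "0 \<le> (LINT x|lborel. ?H x)"
    using integral_mono_AE[OF div_int i] div0 by simp
  then show "0 \<le> (LINT x|lebesgue_on \<Omega>. ?H x)"
    using lebesgue_on_vanishing_outside(2)[OF \<Omega> meas out] by simp
qed

section \<open>Energy inequality for a fixed approximant\<close>

definition "remainder u g x =
  (1 + \<beta>) * (\<bar>u\<bar> * \<bar>u - \<phi> x\<bar>) + \<beta> * (\<bar>\<phi> x\<bar> * \<bar>u - \<phi> x\<bar>)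
  + 2 * \<mu> * (\<bar>(u - \<phi> x) / sqrt (x \<bullet> x + \<delta>)\<bar> * \<bar>\<phi> x / sqrt (x \<bullet> x + \<delta>)\<bar>)
  + 2 * (\<bar>norm (g - grad \<phi> x)\<bar> * \<bar>norm (grad \<phi> x)\<bar>)
  + 6 * (2 + \<nu>) * (\<bar>norm (g - grad \<phi> x)\<bar> * \<bar>\<phi> x / sqrt (x \<bullet> x + \<delta>)\<bar>)"

text \<open>The first bracket is the integrand of the weak equation tested with
  \<open>\<psi>\<close>, whose integral is 0; the second is the integrand of
  \<open>integrated_picone\<close>, whose integral is nonnegative. In their difference u and g occur
  beside \<phi> and grad \<phi>, so what \<open>absorption_lower_bound\<close> does not cover is an
  error: every term of \<open>remainder\<close> has a factor u - \<phi> or g - grad \<phi>.\<close>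

lemma pointwise_energy_inequality:
  assumes "0 < u" "1 \<le> p" "p \<le> q" "\<mu> \<ge> 0"
    and large: "\<And>s. A \<le> s \<Longrightarrow> \<beta> + 1 \<le> s powr (q - 1) - s powr (p - 1)"
  shows "(if w x \<le> u then u * (w x * h x) else 0)
    \<le> (g \<bullet> grad \<psi> x - \<mu> * (u / (norm x)\<^sup>2 * \<psi> x) - (u powr p * \<psi> x - u powr q * \<psi> x))
      - (grad \<phi> x \<bullet> grad \<psi> x - \<mu> * (\<phi> x * \<psi> x / (x \<bullet> x)) + \<beta> * A * (\<phi> x * h x))
      + remainder u g x"
proof (cases "x = 0")
  case True
  have "\<beta> \<ge> 0" using assms(4) by (simp add: \<beta>_eq)
  then have "0 \<le> remainder u g x"
    unfolding remainder_def using assms(4) \<nu> by (intro add_nonneg_nonneg mult_nonneg_nonneg) auto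
  then show ?thesis
    using True near_0[of 0] grad_near_0[of 0] \<delta> by (simp add: \<psi>_def)
next
  case False
  have \<beta>: "\<beta> \<ge> 0" using assms(4) by (simp add: \<beta>_eq)
  define d where "d = u - \<phi> x"
  define e where "e = g - grad \<phi> x"
  define r where "r = sqrt (x \<bullet> x + \<delta>)"
  have s: "x \<bullet> x > 0" using False by simp
  have r: "r > 0" "r * r = x \<bullet> x + \<delta>"
    using add_pos_pos[OF s \<delta>] by (simp_all add: r_def)
  have wp: "w x > 0" using w_pos[OF False] .
  have \<psi>_le: "\<psi> x \<le> \<bar>\<phi> x\<bar>" "\<psi> x \<ge> 0"
    using h_le[OF False] wp h_nonneg[of x] by (auto simp: \<psi>_def max_def split: if_splits)
  have abs: "(if w x \<le> u then u * (w x * h x) else 0) - (1 + \<beta>) * (\<bar>u\<bar> * \<bar>d\<bar>)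
      \<le> ((u powr q - u powr p) * w x - \<beta> * A * u) * h x"
    unfolding d_def using barrier_ge[OF _ _ False, of \<nu> A] \<nu> A h_nonneg h_le[OF False] \<beta> assms
    by (intro absorption_lower_bound) auto
  have t1: "- (\<beta> * (\<bar>\<phi> x\<bar> * \<bar>d\<bar>)) \<le> \<beta> * A * d * h x"
  proof -
    have "A * h x \<le> w x * h x"
      using barrier_ge[OF _ _ False, of \<nu> A] \<nu> A h_nonneg by (intro mult_right_mono) auto
    also have "\<dots> \<le> \<bar>\<phi> x\<bar>" using \<psi>_le by (simp add: \<psi>_def)
    finally have "\<beta> * ((A * h x) * \<bar>d\<bar>) \<le> \<beta> * (\<bar>\<phi> x\<bar> * \<bar>d\<bar>)"
      using \<beta> by (intro mult_left_mono mult_right_mono) auto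
    moreover have "\<bar>\<beta> * A * d * h x\<bar> = \<beta> * ((A * h x) * \<bar>d\<bar>)"
      using \<beta> A h_nonneg[of x] by (simp add: abs_mult)
    ultimately show ?thesis by linarith
  qed
  \<comment> \<open>The factor 2 replaces 1 / (x \<bullet> x) by 1 / (x \<bullet> x + \<delta>):
    \<open>\<psi>\<close> vanishes for x \<bullet> x < \<delta>, and elsewhere x \<bullet> x +
    \<delta> is at most twice x \<bullet> x.\<close>
  have t2: "\<mu> * (d * (\<psi> x / (x \<bullet> x))) \<le> 2 * \<mu> * (\<bar>d / r\<bar> * \<bar>\<phi> x / r\<bar>)"
  proof -
    have "\<psi> x / (x \<bullet> x) \<le> 2 * \<bar>\<phi> x\<bar> / (r * r)"
    proof (cases "x \<bullet> x < \<delta>")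
      case True
      then have "\<psi> x = 0" using near_0(1) by (simp add: \<psi>_def)
      moreover have "0 \<le> 2 * \<bar>\<phi> x\<bar> / (r * r)" by simp
      ultimately show ?thesis by simp
    next
      case False
      then have "\<psi> x * (r * r) \<le> \<bar>\<phi> x\<bar> * (2 * (x \<bullet> x))"
        unfolding r(2) using \<psi>_le \<delta> by (intro mult_mono) auto
      moreover have "a / d \<le> 2 * b / c" if "a * c \<le> b * (2 * d)" "c > 0" "d > 0" for a b c d :: real
        using that by (simp add: field_simps)
      ultimately show ?thesis using s r(1) by simp
    qed
    then have "\<bar>d\<bar> * (\<psi> x / (x \<bullet> x)) \<le> \<bar>d\<bar> * (2 * \<bar>\<phi> x\<bar> / (r * r))"
      by (intro mult_left_mono) auto
    also have "\<dots> = 2 * (\<bar>d / r\<bar> * \<bar>\<phi> x / r\<bar>)"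
      using r by (simp add: abs_divide)
    finally have "\<mu> * (\<bar>d\<bar> * (\<psi> x / (x \<bullet> x))) \<le> \<mu> * (2 * (\<bar>d / r\<bar> * \<bar>\<phi> x / r\<bar>))"
      using assms(4) by (rule mult_left_mono)
    moreover have "\<mu> * (d * (\<psi> x / (x \<bullet> x))) \<le> \<mu> * (\<bar>d\<bar> * (\<psi> x / (x \<bullet> x)))"
      using assms(4) \<psi>_le s by (intro mult_left_mono mult_right_mono) auto
    ultimately show ?thesis by (simp only: mult.assoc mult.left_commute[of \<mu> 2]) (rule order_trans)
  qed
  have t3: "- (2 * (norm e * norm (grad \<phi> x)) + 6 * (2 + \<nu>) * (norm e * \<bar>\<phi> x / r\<bar>)) \<le> e \<bullet> grad \<psi> x"
  proof -
    have "\<bar>e \<bullet> grad \<psi> x\<bar> \<le> norm e * norm (grad \<psi> x)" by (rule Cauchy_Schwarz_ineq2)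
    also have "\<dots> \<le> norm e * (2 * norm (grad \<phi> x) + 6 * (2 + \<nu>) * (\<bar>\<phi> x\<bar> / r))"
      using norm_grad_\<psi>_le[of x] unfolding r_def by (intro mult_left_mono) auto
    also have "\<dots> = 2 * (norm e * norm (grad \<phi> x)) + 6 * (2 + \<nu>) * (norm e * \<bar>\<phi> x / r\<bar>)"
      using r by (simp add: abs_divide distrib_left)
    finally show ?thesis by linarith
  qed
  \<comment> \<open>Writing \<open>\<phi> x = u - d\<close> in the term with \<beta> produces the
    combination bounded in \<open>abs\<close> and leaves a multiple of \<open>d\<close> for
    \<open>t1\<close>.\<close>
  have id: "(g \<bullet> grad \<psi> x - \<mu> * (u / (norm x)\<^sup>2 * \<psi> x) - (u powr p * \<psi> x - u powr q * \<psi> x))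
      - (grad \<phi> x \<bullet> grad \<psi> x - \<mu> * (\<phi> x * \<psi> x / (x \<bullet> x)) + \<beta> * A * (\<phi> x * h x))
    = e \<bullet> grad \<psi> x - \<mu> * (d * (\<psi> x / (x \<bullet> x)))
      + ((u powr q - u powr p) * w x - \<beta> * A * u) * h x + \<beta> * A * d * h x"
    unfolding power2_norm_eq_inner e_def d_def \<psi>_def inner_diff_left using s by (simp add: field_simps)
  have R: "remainder u g x = (1 + \<beta>) * (\<bar>u\<bar> * \<bar>d\<bar>) + \<beta> * (\<bar>\<phi> x\<bar> * \<bar>d\<bar>) + 2 * \<mu> * (\<bar>d / r\<bar> * \<bar>\<phi> x / r\<bar>)
      + 2 * (norm e * norm (grad \<phi> x)) + 6 * (2 + \<nu>) * (norm e * \<bar>\<phi> x / r\<bar>)"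
    by (simp add: remainder_def d_def e_def r_def)
  show ?thesis
    unfolding id R using abs t1 t2 t3 by linarith
qed

lemma L2_weighted:
  assumes "L2 (lebesgue_on \<Omega>) f"
  shows "L2 (lebesgue_on \<Omega>) (\<lambda>x. f x / sqrt (x \<bullet> x + \<delta>))"
proof (rule L2_dominated[OF _ assms])
  have "continuous_on UNIV (\<lambda>x::'a. sqrt (x \<bullet> x + \<delta>))" by (intro continuous_intros)
  then have "(\<lambda>x::'a. sqrt (x \<bullet> x + \<delta>)) \<in> borel_measurable (lebesgue_on \<Omega>)"
    by (rule borel_measurable_lebesgue_on_continuous)
  then show "(\<lambda>x. f x / sqrt (x \<bullet> x + \<delta>)) \<in> borel_measurable (lebesgue_on \<Omega>)"
    using L2_measurable[OF assms] by (intro borel_measurable_divide)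
  fix x :: 'a
  have "\<bar>f x / sqrt (x \<bullet> x + \<delta>)\<bar> = \<bar>f x\<bar> / sqrt (x \<bullet> x + \<delta>)"
    using \<delta> by (simp add: abs_divide)
  also have "\<dots> \<le> \<bar>f x\<bar> / sqrt \<delta>"
    using \<delta> add_nonneg_pos[OF inner_ge_zero \<delta>, of x] by (intro divide_left_mono) auto
  finally show "\<bar>f x / sqrt (x \<bullet> x + \<delta>)\<bar> \<le> 1 / sqrt \<delta> * \<bar>f x\<bar>" by simp
qed

text \<open>The pointwise inequality is integrated: the equation removes the first bracket, Picone's
  inequality has the favourable sign, and each error product is split by Cauchy-Schwarz. The
  coefficients on the right are free of \<delta>, which survives only inside the Hardy
  quotients.\<close>

lemma energy_inequality:
  fixes u :: "'a \<Rightarrow> real" and g :: "'a \<Rightarrow> 'a"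
  defines "M \<equiv> lebesgue_on \<Omega>"
  assumes "open \<Omega>" "1 \<le> p" "p \<le> q" "\<mu> \<ge> 0"
    and large: "\<And>s. A \<le> s \<Longrightarrow> \<beta> + 1 \<le> s powr (q - 1) - s powr (p - 1)"
    and u: "L2 M u" "AE x in M. 0 < u x"
    and g: "g \<in> borel_measurable M" "L2 M (\<lambda>x. norm (g x))"
    and up: "integrable M (\<lambda>x. u x powr p * \<psi> x)" "integrable M (\<lambda>x. u x powr q * \<psi> x)"
    and eq: "(LINT x|M. g x \<bullet> grad \<psi> x) - \<mu> * (LINT x|M. u x / (norm x)\<^sup>2 * \<psi> x)
      = (LINT x|M. u x powr p * \<psi> x) - (LINT x|M. u x powr q * \<psi> x)"
  shows "(LINT x|M. (if w x \<le> u x then u x * (w x * h x) else 0))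
    \<le> (1 + \<beta>) * (L2_norm M u * L2_norm M (\<lambda>x. u x - \<phi> x))
      + \<beta> * (L2_norm M \<phi> * L2_norm M (\<lambda>x. u x - \<phi> x))
      + 2 * \<mu> * (L2_norm M (\<lambda>x. (u x - \<phi> x) / sqrt (x \<bullet> x + \<delta>)) * L2_norm M (\<lambda>x. \<phi> x / sqrt (x \<bullet> x + \<delta>)))
      + 2 * (L2_norm M (\<lambda>x. norm (g x - grad \<phi> x)) * L2_norm M (\<lambda>x. norm (grad \<phi> x)))
      + 6 * (2 + \<nu>) * (L2_norm M (\<lambda>x. norm (g x - grad \<phi> x)) * L2_norm M (\<lambda>x. \<phi> x / sqrt (x \<bullet> x + \<delta>)))"
    (is "_ \<le> ?B")
proof -
  have \<beta>: "\<beta> \<ge> 0" using assms(5) by (simp add: \<beta>_eq)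
  have L2\<phi>: "L2 M \<phi>" "L2 M (\<lambda>x. norm (grad \<phi> x))"
    unfolding M_def using L2_test_function[OF \<open>open \<Omega>\<close> test] by auto
  have L2d: "L2 M (\<lambda>x. u x - \<phi> x)"
    by (rule L2_diff[OF u(1) L2\<phi>(1)])
  have m\<phi>: "grad \<phi> \<in> borel_measurable M" "grad \<psi> \<in> borel_measurable M" "h \<in> borel_measurable M" "w \<in> borel_measurable M"
    unfolding M_def using test_function_\<psi> test_function_h smooth_\<phi>
    by (auto intro!: borel_measurable_lebesgue_on_continuous continuous_on_grad continuous_on_smooth
        borel_measurable_barrier simp: test_function_def)
  have L2e: "L2 M (\<lambda>x. norm (g x - grad \<phi> x))"
    by (rule L2_norm_diff[OF g m\<phi>(1) L2\<phi>(2)])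
  note wd = L2_weighted[OF L2d[unfolded M_def], folded M_def]
  note w\<phi> = L2_weighted[OF L2\<phi>(1)[unfolded M_def], folded M_def]
  note prods = u(1)[THEN L2_abs] L2d[THEN L2_abs] L2\<phi>(1)[THEN L2_abs] L2\<phi>(2)[THEN L2_abs] L2e[THEN L2_abs]
    wd[THEN L2_abs] w\<phi>[THEN L2_abs]
  have i_g: "integrable M (\<lambda>x. g x \<bullet> grad \<psi> x)"
  proof (rule Bochner_Integration.integrable_bound)
    show "integrable M (\<lambda>x. norm (g x) * norm (grad \<psi> x))"
      using L2_mult_integrable[OF g(2)] L2_test_function(2)[OF \<open>open \<Omega>\<close> test_function_\<psi>] by (simp add: M_def)
    show "(\<lambda>x. g x \<bullet> grad \<psi> x) \<in> borel_measurable M" using g(1) m\<phi>(2) by measurable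
    show "AE x in M. norm (g x \<bullet> grad \<psi> x) \<le> norm (norm (g x) * norm (grad \<psi> x))"
      using Cauchy_Schwarz_ineq2 by (auto simp: abs_mult)
  qed
  have i_u: "integrable M (\<lambda>x. u x / (norm x)\<^sup>2 * \<psi> x)"
    using L2_mult_integrable[OF u(1) L2_test_function(1)[OF \<open>open \<Omega>\<close> test_function_\<psi>_hardy, folded M_def]]
    by (simp add: power2_norm_eq_inner)
  define W where "W x = g x \<bullet> grad \<psi> x - \<mu> * (u x / (norm x)\<^sup>2 * \<psi> x) - (u x powr p * \<psi> x - u x powr q * \<psi> x)" for x
  define P where "P x = grad \<phi> x \<bullet> grad \<psi> x - \<mu> * (\<phi> x * \<psi> x / (x \<bullet> x)) + \<beta> * A * (\<phi> x * h x)" for x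
  define R where "R x = remainder (u x) (g x) x" for x
  have W: "integrable M W" "(LINT x|M. W x) = 0"
  proof -
    show "integrable M W"
      unfolding W_def by (intro Bochner_Integration.integrable_diff integrable_mult_right i_g i_u up)
    have "(LINT x|M. W x) = (LINT x|M. g x \<bullet> grad \<psi> x) - \<mu> * (LINT x|M. u x / (norm x)\<^sup>2 * \<psi> x)
      - ((LINT x|M. u x powr p * \<psi> x) - (LINT x|M. u x powr q * \<psi> x))"
      unfolding W_def
      by (simp only: Bochner_Integration.integral_diff Bochner_Integration.integrable_diff integrable_mult_right
          integral_mult_right_zero i_g i_u up)
    then show "(LINT x|M. W x) = 0" using eq by simp
  qed
  have P: "integrable M P" "0 \<le> (LINT x|M. P x)"
    using integrated_picone[OF \<open>open \<Omega>\<close>] unfolding P_def[abs_def] M_def by auto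
  have R: "integrable M R"
    "(LINT x|M. R x) \<le> ?B"
  proof -
    note ints = integrable_mult_right[OF L2_mult_integrable[OF prods(1,2)], of "1 + \<beta>"]
      integrable_mult_right[OF L2_mult_integrable[OF prods(3,2)], of \<beta>]
      integrable_mult_right[OF L2_mult_integrable[OF prods(6,7)], of "2 * \<mu>"]
      integrable_mult_right[OF L2_mult_integrable[OF prods(5,4)], of 2]
      integrable_mult_right[OF L2_mult_integrable[OF prods(5,7)], of "6 * (2 + \<nu>)"]
    show "integrable M R"
      unfolding R_def remainder_def by (intro Bochner_Integration.integrable_add ints)
    have "(LINT x|M. R x) = (LINT x|M. (1 + \<beta>) * (\<bar>u x\<bar> * \<bar>u x - \<phi> x\<bar>)) + (LINT x|M. \<beta> * (\<bar>\<phi> x\<bar> * \<bar>u x - \<phi> x\<bar>))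
      + (LINT x|M. 2 * \<mu> * (\<bar>(u x - \<phi> x) / sqrt (x \<bullet> x + \<delta>)\<bar> * \<bar>\<phi> x / sqrt (x \<bullet> x + \<delta>)\<bar>))
      + (LINT x|M. 2 * (\<bar>norm (g x - grad \<phi> x)\<bar> * \<bar>norm (grad \<phi> x)\<bar>))
      + (LINT x|M. 6 * (2 + \<nu>) * (\<bar>norm (g x - grad \<phi> x)\<bar> * \<bar>\<phi> x / sqrt (x \<bullet> x + \<delta>)\<bar>))"
      unfolding R_def remainder_def
      by (simp only: Bochner_Integration.integral_add Bochner_Integration.integrable_add ints)
    \<comment> \<open>The redundant absolute values around norms in \<open>remainder\<close> give
      each summand the shape required by \<open>L2_Cauchy_Schwarz_scaled\<close>.\<close>
    also have "\<dots> \<le> ?B"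
      using \<beta> \<open>\<mu> \<ge> 0\<close> \<nu> by (intro add_mono L2_Cauchy_Schwarz_scaled u(1) L2d L2\<phi> L2e wd w\<phi>) auto
    finally show "(LINT x|M. R x) \<le> ?B" .
  qed
  let ?T = "\<lambda>x. if w x \<le> u x then u x * (w x * h x) else 0"
  have WPR: "integrable M (\<lambda>x. W x - P x + R x)"
    by (intro Bochner_Integration.integrable_add Bochner_Integration.integrable_diff W P R)
  have le: "AE x in M. ?T x \<le> W x - P x + R x"
    using u(2) unfolding W_def P_def R_def
    by eventually_elim (rule pointwise_energy_inequality[OF _ assms(3,4,5) large])
  \<comment> \<open>Only the majorant has to be integrable here. A non-integrable left-hand side
    would have the default integral 0, which is harmless because the majorant is nonnegative almost
    everywhere.\<close>
  have "(LINT x|M. ?T x) \<le> (LINT x|M. W x - P x + R x)"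
  proof (rule integral_mono_AE'[OF WPR le])
    have "0 \<le> ?T x" if "0 < u x" for x
      using that h_nonneg[of x] w_pos[of x] by (cases "x = 0") auto
    note T = this
    show "AE x in M. 0 \<le> W x - P x + R x"
      using u(2) le by eventually_elim (rule order_trans[OF T])
  qed
  also have "\<dots> = (LINT x|M. W x) - (LINT x|M. P x) + (LINT x|M. R x)"
    by (simp only: Bochner_Integration.integral_add Bochner_Integration.integral_diff
        Bochner_Integration.integrable_diff W(1) P(1) R(1))
  also have "\<dots> \<le> (LINT x|M. R x)" using W(2) P(2) by simp
  also note R(2)
  finally show ?thesis .
qed

end

section \<open>Hardy's inequality on the domain and its extension to limits\<close>

lemma test_function_diff:
  assumes "test_function \<Omega> f" "test_function \<Omega> g"
  shows "test_function \<Omega> (\<lambda>x. f x - g x)"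
proof -
  have "Ck k (\<lambda>x. f x + (- 1) * g x)" for k
    unfolding Ck_on_UNIV[symmetric]
    by (intro Ck_on_add Ck_on_mult Ck_on_const test_function_Ck_on[OF assms(1)] test_function_Ck_on[OF assms(2)]) auto
  then have "smooth (\<lambda>x. f x - g x)" by (simp add: smooth_def)
  moreover have sub: "closure {x. f x - g x \<noteq> 0} \<subseteq> closure {x. f x \<noteq> 0} \<union> closure {x. g x \<noteq> 0}"
    unfolding closure_Un[symmetric] by (intro closure_mono) auto
  moreover have "bounded (closure {x. f x - g x \<noteq> 0})"
    using assms by (intro bounded_subset[OF _ sub]) (auto simp: test_function_def compact_imp_bounded)
  ultimately show ?thesis
    using assms unfolding test_function_def by (auto simp: compact_eq_bounded_closed)
qed

lemma L2_norm_hardy_test_function: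
  fixes \<phi> :: "'a::euclidean_space \<Rightarrow> real"
  assumes "open \<Omega>" "test_function \<Omega> \<phi>" "DIM('a) \<ge> 3" "\<delta> > 0"
  shows "L2_norm (lebesgue_on \<Omega>) (\<lambda>x. \<phi> x / sqrt (x \<bullet> x + \<delta>))
    \<le> 2 * L2_norm (lebesgue_on \<Omega>) (\<lambda>x. norm (grad \<phi> x))"
proof -
  obtain K where K: "compact K" "K \<subseteq> \<Omega>" "\<And>x. x \<notin> K \<Longrightarrow> \<phi> x = 0"
    using test_function_support[OF assms(2)] by metis
  have pos: "0 < x \<bullet> x + \<delta>" for x :: 'a
    using assms(4) by (simp add: add_nonneg_pos)
  then have nz: "x \<bullet> x + \<delta> \<noteq> 0" for x :: 'a by (metis less_irrefl)
  have "continuous_on UNIV (\<lambda>x. \<phi> x / sqrt (x \<bullet> x + \<delta>))"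
    using assms(2) by (intro continuous_intros continuous_on_smooth) (auto simp: test_function_def nz)
  from L2_continuous_compact_support(2)[OF assms(1) this K(1,2)]
  have "(LINT x|lebesgue_on \<Omega>. (\<phi> x / sqrt (x \<bullet> x + \<delta>))\<^sup>2) = (LINT x|lborel. (\<phi> x / sqrt (x \<bullet> x + \<delta>))\<^sup>2)"
    using K(3) by simp
  also have "\<dots> = (LINT x|lborel. (\<phi> x)\<^sup>2 / (x \<bullet> x + \<delta>))"
    using pos by (simp add: power_divide less_imp_le)
  also have "\<dots> \<le> 4 * (LINT x|lborel. (norm (grad \<phi> x))\<^sup>2)"
    by (rule regularized_hardy_inequality[OF assms(2-4)])
  also have "\<dots> = 4 * (LINT x|lebesgue_on \<Omega>. (norm (grad \<phi> x))\<^sup>2)"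
    using L2_test_function(3)[OF assms(1,2)] by simp
  finally have "sqrt (LINT x|lebesgue_on \<Omega>. (\<phi> x / sqrt (x \<bullet> x + \<delta>))\<^sup>2)
      \<le> sqrt (2\<^sup>2 * (LINT x|lebesgue_on \<Omega>. (norm (grad \<phi> x))\<^sup>2))"
    by (intro real_sqrt_le_mono) simp
  also have "\<dots> = 2 * sqrt (LINT x|lebesgue_on \<Omega>. (norm (grad \<phi> x))\<^sup>2)"
    by (simp add: real_sqrt_mult)
  finally show ?thesis unfolding L2_norm_def .
qed

text \<open>Hardy's inequality is available for test functions only, so it is applied to \<phi> j -
  \<phi> k and j tends to infinity. The remaining part u - \<phi> j is handled with the crude weight
  bound 1 / sqrt \<delta>; as \<delta> is fixed while j varies, this constant disappears in the
  limit.\<close>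

lemma L2_norm_hardy_limit:
  fixes u :: "'a::euclidean_space \<Rightarrow> real" and \<Omega> :: "'a set"
  defines "M \<equiv> lebesgue_on \<Omega>"
  assumes "open \<Omega>" "DIM('a) \<ge> 3" "\<delta> > 0"
    and u: "L2 M u" and g: "g \<in> borel_measurable M" "L2 M (\<lambda>x. norm (g x))"
    and test: "\<And>k. test_function \<Omega> (\<phi> k)"
    and D: "(\<lambda>k. L2_norm M (\<lambda>x. u x - \<phi> k x)) \<longlonglongrightarrow> 0"
    and E: "(\<lambda>k. L2_norm M (\<lambda>x. norm (g x - grad (\<phi> k) x))) \<longlonglongrightarrow> 0"
  shows "L2_norm M (\<lambda>x. (u x - \<phi> k x) / sqrt (x \<bullet> x + \<delta>)) \<le> 2 * L2_norm M (\<lambda>x. norm (g x - grad (\<phi> k) x))"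
proof -
  define r where "r x = sqrt (x \<bullet> x + \<delta>)" for x :: 'a
  have r_ge: "sqrt \<delta> \<le> r x" for x by (simp add: r_def)
  have r_pos: "r x > 0" for x
    using r_ge[of x] assms(4) by (meson less_le_trans real_sqrt_gt_zero)
  have r_meas: "r \<in> borel_measurable M"
    unfolding M_def r_def[abs_def] by (intro borel_measurable_lebesgue_on_continuous continuous_intros)
  have meas: "\<phi> j \<in> borel_measurable M" "grad (\<phi> j) \<in> borel_measurable M" for j
    using test[of j] unfolding M_def
    by (auto intro!: borel_measurable_lebesgue_on_continuous continuous_on_grad continuous_on_smooth
        simp: test_function_def)
  have L2\<phi>: "L2 M (\<phi> j)" "L2 M (\<lambda>x. norm (grad (\<phi> j) x))" for j
    unfolding M_def using L2_test_function[OF \<open>open \<Omega>\<close> test] by auto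
  have L2d: "L2 M (\<lambda>x. u x - \<phi> j x)" for j by (rule L2_diff[OF u L2\<phi>(1)])
  have L2e: "L2 M (\<lambda>x. norm (g x - grad (\<phi> j) x))" for j
    by (rule L2_norm_diff[OF g meas(2) L2\<phi>(2)])
  have weight: "\<bar>f / r x\<bar> \<le> 1 / sqrt \<delta> * \<bar>f\<bar>" for f x
  proof -
    have "\<bar>f\<bar> / r x \<le> \<bar>f\<bar> / sqrt \<delta>"
      using r_ge[of x] r_pos[of x] assms(4) by (intro divide_left_mono) auto
    then show ?thesis using r_pos[of x] by (simp add: abs_divide)
  qed
  have L2w: "L2 M (\<lambda>x. f x / r x)" if "L2 M f" for f
    using that L2_measurable[OF that] r_meas weight
    by (intro L2_dominated[OF _ that, of _ "1 / sqrt \<delta>"]) auto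
  have bound: "L2_norm M (\<lambda>x. (u x - \<phi> k x) / r x) \<le> 1 / sqrt \<delta> * L2_norm M (\<lambda>x. u x - \<phi> j x)
      + 2 * (L2_norm M (\<lambda>x. norm (g x - grad (\<phi> j) x)) + L2_norm M (\<lambda>x. norm (g x - grad (\<phi> k) x)))" for j
  proof -
    define f where "f x = \<phi> j x - \<phi> k x" for x
    have tf: "test_function \<Omega> f"
      unfolding f_def[abs_def] by (rule test_function_diff[OF test test])
    have gf: "grad f x = grad (\<phi> j) x - grad (\<phi> k) x" for x
      unfolding f_def[abs_def] using test
      by (intro grad_eqI has_derivative_eq_rhs[OF has_derivative_diff[OF
              smooth_has_derivative_grad smooth_has_derivative_grad]])
        (auto simp: test_function_def inner_diff_left)
    have "L2_norm M (\<lambda>x. (u x - \<phi> k x) / r x) = L2_norm M (\<lambda>x. (u x - \<phi> j x) / r x + f x / r x)"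
      by (simp add: f_def flip: add_divide_distrib)
    also have "\<dots> \<le> L2_norm M (\<lambda>x. (u x - \<phi> j x) / r x) + L2_norm M (\<lambda>x. f x / r x)"
      using L2_diff[OF L2\<phi>(1) L2\<phi>(1), of j k] by (intro L2_norm_triangle L2w L2d) (simp add: f_def)
    also have "L2_norm M (\<lambda>x. (u x - \<phi> j x) / r x) \<le> 1 / sqrt \<delta> * L2_norm M (\<lambda>x. u x - \<phi> j x)"
      using L2_measurable[OF L2w[OF L2d]] weight assms(4) by (intro L2_norm_mono L2d) auto
    also have "L2_norm M (\<lambda>x. f x / r x) \<le> 2 * L2_norm M (\<lambda>x. norm (grad f x))"
      using L2_norm_hardy_test_function[OF assms(2) tf assms(3,4)] unfolding M_def r_def .
    also have "L2_norm M (\<lambda>x. norm (grad f x))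
        \<le> 1 * L2_norm M (\<lambda>x. norm (g x - grad (\<phi> j) x) + norm (g x - grad (\<phi> k) x))"
    proof (rule L2_norm_mono[OF _ L2_add[OF L2e L2e]])
      show "(\<lambda>x. norm (grad f x)) \<in> borel_measurable M"
        unfolding gf using meas(2) by measurable
      show "\<bar>norm (grad f x)\<bar> \<le> 1 * \<bar>norm (g x - grad (\<phi> j) x) + norm (g x - grad (\<phi> k) x)\<bar>" for x
        using norm_triangle_ineq4[of "g x - grad (\<phi> k) x" "g x - grad (\<phi> j) x"] by (simp add: gf)
    qed simp
    also have "L2_norm M (\<lambda>x. norm (g x - grad (\<phi> j) x) + norm (g x - grad (\<phi> k) x))
        \<le> L2_norm M (\<lambda>x. norm (g x - grad (\<phi> j) x)) + L2_norm M (\<lambda>x. norm (g x - grad (\<phi> k) x))"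
      by (rule L2_norm_triangle[OF L2e L2e])
    finally show ?thesis by simp
  qed
  have "(\<lambda>j. 1 / sqrt \<delta> * L2_norm M (\<lambda>x. u x - \<phi> j x)
      + 2 * (L2_norm M (\<lambda>x. norm (g x - grad (\<phi> j) x)) + L2_norm M (\<lambda>x. norm (g x - grad (\<phi> k) x))))
    \<longlonglongrightarrow> 1 / sqrt \<delta> * 0 + 2 * (0 + L2_norm M (\<lambda>x. norm (g x - grad (\<phi> k) x)))"
    by (intro tendsto_intros D E)
  then have "L2_norm M (\<lambda>x. (u x - \<phi> k x) / r x) \<le> 1 / sqrt \<delta> * 0 + 2 * (0 + L2_norm M (\<lambda>x. norm (g x - grad (\<phi> k) x)))"
    using bound by (intro LIMSEQ_le_const) auto
  then show ?thesis by (simp add: r_def)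
qed

section \<open>Integrability and weak gradients in the weak formulation\<close>

lemma locally_integrable_mult_test_function:
  assumes "open \<Omega>" "locally_integrable \<Omega> g" "test_function \<Omega> f"
  shows "integrable (lebesgue_on \<Omega>) (\<lambda>x. (g x \<bullet> b) * f x)"
proof -
  obtain K where K: "compact K" "K \<subseteq> \<Omega>" "\<And>x. x \<notin> K \<Longrightarrow> f x = 0"
    using test_function_support[OF assms(3)] by metis
  have c: "continuous_on UNIV f"
    using assms(3) by (intro continuous_on_smooth) (simp add: test_function_def)
  obtain C where C: "\<And>x. \<bar>f x\<bar> \<le> C"
    using continuous_compact_support_bounded[OF c K(1,3)] by metis
  have gK: "integrable (lebesgue_on K) (\<lambda>x. g x \<bullet> b)"
    using assms(2) K(1,2) unfolding locally_integrable_def by auto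
  have iK: "integrable (lebesgue_on K) (\<lambda>x. (g x \<bullet> b) * f x)"
  proof (rule Bochner_Integration.integrable_bound)
    show "integrable (lebesgue_on K) (\<lambda>x. C * (g x \<bullet> b))" using gK by simp
    show "(\<lambda>x. (g x \<bullet> b) * f x) \<in> borel_measurable (lebesgue_on K)"
      using gK borel_measurable_lebesgue_on_continuous[OF c] by (intro borel_measurable_times) auto
    have "\<bar>g x \<bullet> b\<bar> * \<bar>f x\<bar> \<le> \<bar>g x \<bullet> b\<bar> * \<bar>C\<bar>" for x
      using C[of x] by (intro mult_left_mono) auto
    then show "AE x in lebesgue_on K. norm ((g x \<bullet> b) * f x) \<le> norm (C * (g x \<bullet> b))"
      by (simp add: abs_mult mult.commute)
  qed
  have K_sets: "K \<in> sets lebesgue" using K(1) by (simp add: compact_imp_closed)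
  have "(\<lambda>x. indicator K x *\<^sub>R ((g x \<bullet> b) * f x)) = (\<lambda>x. indicator \<Omega> x *\<^sub>R ((g x \<bullet> b) * f x))"
    using K(2,3) by (auto simp: fun_eq_iff indicator_def)
  then show ?thesis
    using iK K_sets assms(1) by (simp add: integrable_restrict_space)
qed

text \<open>The partial derivatives of a test function are again test functions, so weak gradients of
  the same function agree when paired with gradients of test functions; no uniqueness almost
  everywhere is required.\<close>

lemma weak_gradient_pairing_unique:
  assumes "open \<Omega>" "has_weak_gradient \<Omega> u g1" "has_weak_gradient \<Omega> u g2" "test_function \<Omega> f"
  shows "(LINT x|lebesgue_on \<Omega>. g1 x \<bullet> grad f x) = (LINT x|lebesgue_on \<Omega>. g2 x \<bullet> grad f x)"
proof -
  have "(LINT x|lebesgue_on \<Omega>. g x \<bullet> grad f x)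
      = (\<Sum>b\<in>Basis. - (LINT x|lebesgue_on \<Omega>. u x * (grad (\<lambda>y. grad f y \<bullet> b) x \<bullet> b)))"
    if "has_weak_gradient \<Omega> u g" for g
  proof -
    have "(LINT x|lebesgue_on \<Omega>. g x \<bullet> grad f x) = (LINT x|lebesgue_on \<Omega>. (\<Sum>b\<in>Basis. (g x \<bullet> b) * (grad f x \<bullet> b)))"
      by (intro Bochner_Integration.integral_cong refl euclidean_inner)
    also have "\<dots> = (\<Sum>b\<in>Basis. LINT x|lebesgue_on \<Omega>. (g x \<bullet> b) * (grad f x \<bullet> b))"
      using that assms(1,4)
      by (intro Bochner_Integration.integral_sum locally_integrable_mult_test_function test_function_partial)
        (auto simp: has_weak_gradient_def)
    also have "\<dots> = (\<Sum>b\<in>Basis. - (LINT x|lebesgue_on \<Omega>. u x * (grad (\<lambda>y. grad f y \<bullet> b) x \<bullet> b)))"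
    proof (rule sum.cong[OF refl])
      fix b :: 'a assume b: "b \<in> Basis"
      have "(LINT x|lebesgue_on \<Omega>. u x * (grad (\<lambda>y. grad f y \<bullet> b) x \<bullet> b))
          = - (LINT x|lebesgue_on \<Omega>. (g x \<bullet> b) * (grad f x \<bullet> b))"
        using that test_function_partial[OF assms(4) b] b unfolding has_weak_gradient_def by blast
      then show "(LINT x|lebesgue_on \<Omega>. (g x \<bullet> b) * (grad f x \<bullet> b))
          = - (LINT x|lebesgue_on \<Omega>. u x * (grad (\<lambda>y. grad f y \<bullet> b) x \<bullet> b))"
        by simp
    qed
    finally show ?thesis .
  qed
  then show ?thesis using assms(2,3) by simp
qed

text \<open>The power u^r is at most u + u^(q+1). The first summand is paired with f in L^2, the
  second is integrable by assumption and f is bounded.\<close>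

lemma integrable_powr_mult_test_function:
  assumes "open \<Omega>" "L2 (lebesgue_on \<Omega>) u" "AE x in lebesgue_on \<Omega>. 0 < u x" "Lp (q + 1) \<Omega> u"
    and "test_function \<Omega> f" "1 \<le> r" "r \<le> q"
  shows "integrable (lebesgue_on \<Omega>) (\<lambda>x. u x powr r * f x)"
proof -
  obtain K where K: "compact K" "\<And>x. x \<notin> K \<Longrightarrow> f x = 0"
    using test_function_support[OF assms(5)] by metis
  have c: "continuous_on UNIV f"
    using assms(5) by (intro continuous_on_smooth) (simp add: test_function_def)
  obtain C where C: "C \<ge> 0" "\<And>x. \<bar>f x\<bar> \<le> C"
    using continuous_compact_support_bounded[OF c K] by metis
  have m: "u \<in> borel_measurable (lebesgue_on \<Omega>)" "f \<in> borel_measurable (lebesgue_on \<Omega>)"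
    using L2_measurable[OF assms(2)] borel_measurable_lebesgue_on_continuous[OF c] by auto
  show ?thesis
  proof (rule Bochner_Integration.integrable_bound)
    show "integrable (lebesgue_on \<Omega>) (\<lambda>x. \<bar>u x\<bar> * \<bar>f x\<bar> + C * norm (u x) powr (q + 1))"
      using L2_mult_integrable[OF L2_abs[OF assms(2)] L2_abs[OF L2_test_function(1)[OF assms(1,5)]]] assms(4)
      by (intro Bochner_Integration.integrable_add integrable_mult_right) (auto simp: Lp_def)
    show "(\<lambda>x. u x powr r * f x) \<in> borel_measurable (lebesgue_on \<Omega>)"
      using m by measurable
    show "AE x in lebesgue_on \<Omega>. norm (u x powr r * f x) \<le> norm (\<bar>u x\<bar> * \<bar>f x\<bar> + C * norm (u x) powr (q + 1))"
      using assms(3)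
    proof eventually_elim
      case (elim x)
      have "u x powr r * \<bar>f x\<bar> \<le> (u x + u x powr (q + 1)) * \<bar>f x\<bar>"
        using powr_le_add_powr[of "u x" r "q + 1"] elim assms(6,7) by (intro mult_right_mono) auto
      also have "\<dots> \<le> u x * \<bar>f x\<bar> + u x powr (q + 1) * C"
        using C(2)[of x] by (simp add: distrib_right mult_left_mono)
      finally show ?case
        using elim C(1) by (simp add: abs_mult mult.commute)
    qed
  qed
qed

section \<open>Comparison and conclusion\<close>

lemma comparison_principle:
  fixes u :: "'a::euclidean_space \<Rightarrow> real" and \<Omega> :: "'a set"
  defines "M \<equiv> lebesgue_on \<Omega>"
  assumes \<Omega>: "open \<Omega>" and dim: "DIM('a) \<ge> 3"
    and \<nu>: "0 < \<nu>" and \<mu>: "0 \<le> \<mu>" "\<nu> * (real DIM('a) - 2 - \<nu>) = \<mu>"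
    and pq: "1 \<le> p" "p \<le> q" and A: "0 < A"
    and large: "\<And>s. A \<le> s \<Longrightarrow> \<mu> + 2 * real DIM('a) + 1 \<le> s powr (q - 1) - s powr (p - 1)"
    and u: "L2 M u" "AE x in M. 0 < u x"
    and g: "g \<in> borel_measurable M" "L2 M (\<lambda>x. norm (g x))"
    and int: "\<And>\<psi>. test_function \<Omega> \<psi> \<Longrightarrow> integrable M (\<lambda>x. u x powr p * \<psi> x)"
      "\<And>\<psi>. test_function \<Omega> \<psi> \<Longrightarrow> integrable M (\<lambda>x. u x powr q * \<psi> x)"
    and weak: "\<And>\<psi>. test_function \<Omega> \<psi> \<Longrightarrow>
      (LINT x|M. g x \<bullet> grad \<psi> x) - \<mu> * (LINT x|M. u x / (norm x)\<^sup>2 * \<psi> x)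
      = (LINT x|M. u x powr p * \<psi> x) - (LINT x|M. u x powr q * \<psi> x)"
    and test: "\<And>k. test_function \<Omega> (\<phi> k)"
    and D_lim: "(\<lambda>k. L2_norm M (\<lambda>x. u x - \<phi> k x)) \<longlonglongrightarrow> 0"
    and E_lim: "(\<lambda>k. L2_norm M (\<lambda>x. norm (g x - grad (\<phi> k) x))) \<longlonglongrightarrow> 0"
  shows "AE x in M. x \<noteq> 0 \<longrightarrow> u x \<le> barrier \<nu> A x"
proof -
  define \<beta> where "\<beta> = \<mu> + 2 * real DIM('a)"
  have \<beta>: "\<beta> \<ge> 0" using \<mu> by (simp add: \<beta>_def)
  define w where "w = (barrier \<nu> A :: 'a \<Rightarrow> real)"
  \<comment> \<open>This is w h with v in place of \<phi>. The outer factor w cancels the inner 1/w,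
    so \<open>H\<close> is 2-Lipschitz in v uniformly in x; an approximant can thus be exchanged for
    u without any bound on w. At the origin \<open>H\<close> is 0 because w is.\<close>
  define H where "H x v = w x * flat 0 (v / w x - 1)" for x v
  have w_pos: "w x > 0" if "x \<noteq> 0" for x
    using barrier_ge[of \<nu> A x] \<nu> A that by (simp add: w_def)
  have H_nonneg: "H x v \<ge> 0" for x v
    using w_pos[of x] by (cases "x = 0") (auto simp: H_def w_def flat_nonneg)
  have H_lipschitz: "\<bar>H x v - H x v'\<bar> \<le> 2 * \<bar>v - v'\<bar>" for x v v'
  proof (cases "x = 0")
    case False
    have "\<bar>H x v - H x v'\<bar> = w x * \<bar>flat 0 (v / w x - 1) - flat 0 (v' / w x - 1)\<bar>"
      using w_pos[OF False] by (simp add: H_def abs_mult flip: right_diff_distrib)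
    also have "\<dots> \<le> w x * (2 * \<bar>(v / w x - 1) - (v' / w x - 1)\<bar>)"
      using w_pos[OF False] by (intro mult_left_mono flat_0_lipschitz) auto
    also have "(v / w x - 1) - (v' / w x - 1) = (v - v') / w x"
      by (simp add: diff_divide_distrib)
    also have "w x * (2 * \<bar>(v - v') / w x\<bar>) = 2 * \<bar>v - v'\<bar>"
      using w_pos[OF False] by (simp add: abs_divide)
    finally show ?thesis .
  qed (simp add: H_def w_def)
  have H_le: "\<bar>H x v\<bar> \<le> \<bar>v\<bar>" for x v
  proof (cases "x = 0")
    case False
    have "H x v \<le> w x * max (v / w x - 1) 0"
      unfolding H_def using w_pos[OF False] by (intro mult_left_mono flat_0_le) auto
    also have "\<dots> = max (v - w x) 0"
      using w_pos[OF False] by (simp add: max_def field_simps)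
    finally show ?thesis using H_nonneg[of x v] w_pos[OF False] by (simp add: max_def split: if_splits)
  qed (simp add: H_def w_def)
  have w_meas: "w \<in> borel_measurable M"
    unfolding w_def M_def by (rule borel_measurable_barrier)
  note flat_meas = borel_measurable_flat[of 0]
  have meas: "(\<lambda>x. if w x \<le> u x then u x * H x (v x) else 0) \<in> borel_measurable M"
    if "v \<in> borel_measurable M" for v
    unfolding H_def using that L2_measurable[OF u(1)] w_meas flat_meas by measurable
  define t where "t x = (if w x \<le> u x then u x * H x (u x) else 0)" for x
  have int_t: "integrable M (\<lambda>x. if w x \<le> u x then u x * H x (v x) else 0)" if "L2 M v" for v
  proof (rule Bochner_Integration.integrable_bound[OF L2_mult_integrable[OF L2_abs[OF u(1)] L2_abs[OF that]]])
    show "(\<lambda>x. if w x \<le> u x then u x * H x (v x) else 0) \<in> borel_measurable M"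
      using meas[OF L2_measurable[OF that]] .
    have "\<bar>u x\<bar> * \<bar>H x (v x)\<bar> \<le> \<bar>u x\<bar> * \<bar>v x\<bar>" for x
      by (intro mult_left_mono H_le) simp
    then show "AE x in M. norm (if w x \<le> u x then u x * H x (v x) else 0) \<le> norm (\<bar>u x\<bar> * \<bar>v x\<bar>)"
      by (auto simp: abs_mult)
  qed
  have L2\<phi>: "L2 M (\<phi> k)" "L2 M (\<lambda>x. norm (grad (\<phi> k) x))" for k
    unfolding M_def using L2_test_function[OF \<Omega> test] by auto
  have L2d: "L2 M (\<lambda>x. u x - \<phi> k x)" for k by (rule L2_diff[OF u(1) L2\<phi>(1)])
  have m\<phi>: "grad (\<phi> k) \<in> borel_measurable M" for k
    using test[of k] unfolding M_def
    by (auto intro!: borel_measurable_lebesgue_on_continuous continuous_on_grad simp: test_function_def)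
  have L2e: "L2 M (\<lambda>x. norm (g x - grad (\<phi> k) x))" for k
    by (rule L2_norm_diff[OF g m\<phi> L2\<phi>(2)])
  define U where "U = L2_norm M u"
  define G where "G = L2_norm M (\<lambda>x. norm (g x))"
  define D where "D k = L2_norm M (\<lambda>x. u x - \<phi> k x)" for k
  define E where "E k = L2_norm M (\<lambda>x. norm (g x - grad (\<phi> k) x))" for k
  have nonneg: "U \<ge> 0" "G \<ge> 0" "D k \<ge> 0" "E k \<ge> 0" for k
    by (simp_all add: U_def G_def D_def E_def L2_norm_nonneg)
  have \<phi>_le: "L2_norm M (\<phi> k) \<le> U + D k" for k
  proof -
    have "L2_norm M (\<phi> k) \<le> 1 * L2_norm M (\<lambda>x. \<bar>u x\<bar> + \<bar>u x - \<phi> k x\<bar>)"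
      using L2_measurable[OF L2\<phi>(1)]
      by (intro L2_norm_mono L2_add[OF L2_abs[OF u(1)] L2_abs[OF L2d]]) auto
    also have "\<dots> \<le> 1 * (L2_norm M (\<lambda>x. \<bar>u x\<bar>) + L2_norm M (\<lambda>x. \<bar>u x - \<phi> k x\<bar>))"
      by (intro mult_left_mono L2_norm_triangle[OF L2_abs[OF u(1)] L2_abs[OF L2d]]) auto
    finally show ?thesis by (simp add: U_def D_def L2_norm_def)
  qed
  have grad_le: "L2_norm M (\<lambda>x. norm (grad (\<phi> k) x)) \<le> G + E k" for k
  proof -
    have "L2_norm M (\<lambda>x. norm (grad (\<phi> k) x)) \<le> 1 * L2_norm M (\<lambda>x. norm (g x) + norm (g x - grad (\<phi> k) x))"
    proof (rule L2_norm_mono[OF L2_measurable[OF L2\<phi>(2)] L2_add[OF g(2) L2e]])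
      show "\<bar>norm (grad (\<phi> k) x)\<bar> \<le> 1 * \<bar>norm (g x) + norm (g x - grad (\<phi> k) x)\<bar>" for x
        using norm_triangle_ineq4[of "g x" "g x - grad (\<phi> k) x"] by simp
    qed simp
    also have "\<dots> \<le> 1 * (L2_norm M (\<lambda>x. norm (g x)) + L2_norm M (\<lambda>x. norm (g x - grad (\<phi> k) x)))"
      by (intro mult_left_mono L2_norm_triangle[OF g(2) L2e]) auto
    finally show ?thesis by (simp add: G_def E_def)
  qed
  \<comment> \<open>The coefficient 3 + \<beta> is 1 + \<beta> from the energy inequality plus 2
    from exchanging \<phi> k for u inside \<open>H\<close>.\<close>
  have bound: "(LINT x|M. t x) \<le> (3 + \<beta>) * (U * D k) + \<beta> * ((U + D k) * D k)
      + 2 * \<mu> * (2 * E k * (2 * (G + E k))) + 2 * (E k * (G + E k)) + 6 * (2 + \<nu>) * (E k * (2 * (G + E k)))" for k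
  proof -
    obtain K where K: "compact K" "\<And>x. x \<notin> K \<Longrightarrow> \<phi> k x = 0"
      using test_function_support[OF test[of k]] by metis
    have "continuous_on UNIV (\<phi> k)"
      using test[of k] by (intro continuous_on_smooth) (simp add: test_function_def)
    then obtain C where C: "\<And>x. \<bar>\<phi> k x\<bar> \<le> C"
      using continuous_compact_support_bounded K by metis
    \<comment> \<open>This \<delta> depends on k through the supremum bound \<open>C\<close>. The
      limit in k is possible because the bound being proved does not contain \<delta>.\<close>
    obtain \<delta> where \<delta>: "\<delta> > 0" "\<And>x::'a. x \<noteq> 0 \<Longrightarrow> x \<bullet> x < \<delta> \<Longrightarrow> C < barrier \<nu> A x"
      using barrier_blow_up[OF \<nu> A] by metis
    interpret cmp: barrier_comparison \<nu> \<mu> A \<beta> \<delta> \<Omega> "\<phi> k"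
    proof
      show "\<phi> k x < barrier \<nu> A x" if "x \<noteq> 0" "x \<bullet> x < \<delta>" for x
        using C[of x] \<delta>(2)[OF that] by simp
    qed (use \<nu> A \<delta>(1) \<mu> test in \<open>auto simp: \<beta>_def\<close>)
    have hardy: "L2_norm M (\<lambda>x. \<phi> k x / sqrt (x \<bullet> x + \<delta>)) \<le> 2 * (G + E k)"
      using order_trans[OF L2_norm_hardy_test_function[OF \<Omega> test[of k] dim \<delta>(1), folded M_def]
          mult_left_mono[OF grad_le[of k], of 2]] by simp
    have hardy_d: "L2_norm M (\<lambda>x. (u x - \<phi> k x) / sqrt (x \<bullet> x + \<delta>)) \<le> 2 * E k"
      unfolding E_def M_def
      by (rule L2_norm_hardy_limit[OF \<Omega> dim \<delta>(1) u(1)[unfolded M_def] g[unfolded M_def] test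
            D_lim[unfolded M_def] E_lim[unfolded M_def]])
    have "(LINT x|M. t x) \<le> (LINT x|M. (if w x \<le> u x then u x * H x (\<phi> k x) else 0) + 2 * (\<bar>u x\<bar> * \<bar>u x - \<phi> k x\<bar>))"
    proof (rule integral_mono_AE)
      show "integrable M t" unfolding t_def[abs_def] by (rule int_t[OF u(1)])
      show "integrable M (\<lambda>x. (if w x \<le> u x then u x * H x (\<phi> k x) else 0) + 2 * (\<bar>u x\<bar> * \<bar>u x - \<phi> k x\<bar>))"
        by (intro Bochner_Integration.integrable_add integrable_mult_right int_t L2\<phi>(1)
            L2_mult_integrable[OF L2_abs[OF u(1)] L2_abs[OF L2d]])
      show "AE x in M. t x \<le> (if w x \<le> u x then u x * H x (\<phi> k x) else 0) + 2 * (\<bar>u x\<bar> * \<bar>u x - \<phi> k x\<bar>)"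
        using u(2)
      proof eventually_elim
        case (elim x)
        have "u x * H x (u x) \<le> u x * (H x (\<phi> k x) + 2 * \<bar>u x - \<phi> k x\<bar>)"
          using H_lipschitz[of x "u x" "\<phi> k x"] elim by (intro mult_left_mono) auto
        then show ?case using elim by (simp add: t_def distrib_left)
      qed
    qed
    also have "\<dots> = (LINT x|M. (if w x \<le> u x then u x * H x (\<phi> k x) else 0))
        + (LINT x|M. 2 * (\<bar>u x\<bar> * \<bar>u x - \<phi> k x\<bar>))"
      by (intro Bochner_Integration.integral_add integrable_mult_right int_t L2\<phi>(1)
          L2_mult_integrable[OF L2_abs[OF u(1)] L2_abs[OF L2d]])
    also have "(LINT x|M. 2 * (\<bar>u x\<bar> * \<bar>u x - \<phi> k x\<bar>)) \<le> 2 * (U * D k)"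
      unfolding U_def D_def by (rule L2_Cauchy_Schwarz_scaled[OF u(1) L2d]) simp
    also have "(LINT x|M. (if w x \<le> u x then u x * H x (\<phi> k x) else 0))
      \<le> (1 + \<beta>) * (L2_norm M u * L2_norm M (\<lambda>x. u x - \<phi> k x))
      + \<beta> * (L2_norm M (\<phi> k) * L2_norm M (\<lambda>x. u x - \<phi> k x))
      + 2 * \<mu> * (L2_norm M (\<lambda>x. (u x - \<phi> k x) / sqrt (x \<bullet> x + \<delta>)) * L2_norm M (\<lambda>x. \<phi> k x / sqrt (x \<bullet> x + \<delta>)))
      + 2 * (L2_norm M (\<lambda>x. norm (g x - grad (\<phi> k) x)) * L2_norm M (\<lambda>x. norm (grad (\<phi> k) x)))
      + 6 * (2 + \<nu>) * (L2_norm M (\<lambda>x. norm (g x - grad (\<phi> k) x)) * L2_norm M (\<lambda>x. \<phi> k x / sqrt (x \<bullet> x + \<delta>)))"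
      using cmp.energy_inequality[OF \<Omega> pq \<mu>(1) _ u[unfolded M_def] g[unfolded M_def]
          int(1)[OF cmp.test_function_\<psi>, unfolded M_def] int(2)[OF cmp.test_function_\<psi>, unfolded M_def]
          weak[OF cmp.test_function_\<psi>, unfolded M_def]] large
      unfolding M_def H_def w_def cmp.h_def \<beta>_def by simp
    also have "\<dots> \<le> (1 + \<beta>) * (U * D k) + \<beta> * ((U + D k) * D k)
      + 2 * \<mu> * (2 * E k * (2 * (G + E k))) + 2 * (E k * (G + E k)) + 6 * (2 + \<nu>) * (E k * (2 * (G + E k)))"
      unfolding U_def[symmetric] D_def[symmetric] E_def[symmetric]
      using \<beta> \<mu>(1) \<nu> nonneg
      by (intro add_mono mult_mono mult_left_mono mult_nonneg_nonneg order_refl \<phi>_le grad_le hardy hardy_d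
          L2_norm_nonneg add_nonneg_nonneg) auto
    finally show ?thesis by (simp add: algebra_simps)
  qed
  have "(\<lambda>k. (3 + \<beta>) * (U * D k) + \<beta> * ((U + D k) * D k)
      + 2 * \<mu> * (2 * E k * (2 * (G + E k))) + 2 * (E k * (G + E k)) + 6 * (2 + \<nu>) * (E k * (2 * (G + E k))))
    \<longlonglongrightarrow> (3 + \<beta>) * (U * 0) + \<beta> * ((U + 0) * 0)
      + 2 * \<mu> * (2 * 0 * (2 * (G + 0))) + 2 * (0 * (G + 0)) + 6 * (2 + \<nu>) * (0 * (2 * (G + 0)))"
    unfolding D_def E_def by (intro tendsto_intros D_lim E_lim)
  from LIMSEQ_le_const[OF this, of "LINT x|M. t x"] have "(LINT x|M. t x) \<le> 0"
    using bound by simp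
  moreover have t_nonneg: "AE x in M. 0 \<le> t x"
    using u(2) by eventually_elim (simp add: t_def H_nonneg)
  ultimately have "(LINT x|M. t x) = 0"
    using integral_nonneg_AE by (intro antisym) auto
  then have "AE x in M. t x = 0"
    using integral_nonneg_eq_0_iff_AE[OF _ t_nonneg] int_t[OF u(1)] unfolding t_def[abs_def] by simp
  then show ?thesis
    using u(2)
  proof eventually_elim
    case (elim x)
    show ?case
    \<comment> \<open>Strict positivity of \<open>flat 0\<close> on the positive axis is what
      matters now: u > w would make \<open>t x\<close> positive.\<close>
    proof (rule impI, rule ccontr)
      assume x: "x \<noteq> 0" "\<not> u x \<le> barrier \<nu> A x"
      then have "u x / w x - 1 > 0" using w_pos[OF x(1)] by (simp add: w_def)
      then have "H x (u x) > 0" using w_pos[OF x(1)] by (simp add: H_def flat_pos)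
      then show False using elim x by (simp add: t_def w_def)
    qed
  qed
qed

section \<open>Amplitude of the barrier and passage to the stated bound\<close>

lemma powr_difference_unbounded:
  fixes p q c :: real
  assumes "1 \<le> p" "p < q" "0 \<le> c"
  obtains A where "A > 0" "\<And>s. A \<le> s \<Longrightarrow> c \<le> s powr (q - 1) - s powr (p - 1)"
proof
  \<comment> \<open>In s^(q-1) - s^(p-1) = s^(p-1) (s^(q-p) - 1) the first factor is at least 1 for
    s >= 1, so it is enough that s^(q-p) reaches c + 1.\<close>
  define A where "A = (c + 1) powr (1 / (q - p))"
  have A: "A \<ge> 1" unfolding A_def using assms by (intro ge_one_powr_ge_zero) auto
  then show "A > 0" by simp
  fix s assume s: "A \<le> s"
  have "c + 1 = A powr (q - p)" using assms by (simp add: A_def powr_powr)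
  also have "\<dots> \<le> s powr (q - p)" using s A assms by (intro powr_mono2) auto
  finally have "c \<le> 1 * (s powr (q - p) - 1)" by simp
  also have "\<dots> \<le> s powr (p - 1) * (s powr (q - p) - 1)"
    using s A assms \<open>c \<le> 1 * (s powr (q - p) - 1)\<close> by (intro mult_right_mono ge_one_powr_ge_zero) auto
  also have "\<dots> = s powr (q - 1) - s powr (p - 1)"
    by (simp add: right_diff_distrib flip: powr_add)
  finally show "c \<le> s powr (q - 1) - s powr (p - 1)" .
qed

text \<open>A continuous function that is positive somewhere on an open set is positive on a
  nonempty open subset, which is not negligible. This yields the bound at every point for a
  continuous representative.\<close>

lemma AE_lebesgue_on_continuous_le:
  fixes f :: "'a::euclidean_space \<Rightarrow> real"
  assumes "open S" "continuous_on S f" "AE x in lebesgue_on S. f x \<le> 0" "x \<in> S"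
  shows "f x \<le> 0"
proof (rule ccontr)
  assume "\<not> f x \<le> 0"
  define T where "T = {y \<in> S. 0 < f y}"
  have T: "open T"
    using continuous_open_preimage[OF assms(2,1) open_greaterThan[of 0]]
    by (simp add: T_def vimage_def Int_def)
  have "AE y in lebesgue. y \<in> S \<longrightarrow> f y \<le> 0"
    using assms(1,3) by (simp add: AE_restrict_space_iff)
  then have "AE y in lebesgue. y \<notin> T"
    by eventually_elim (auto simp: T_def)
  then have "negligible T"
    using T by (simp add: negligible_iff_null_sets AE_iff_null_sets)
  moreover have "T \<noteq> {}"
    using assms(4) \<open>\<not> f x \<le> 0\<close> by (auto simp: T_def)
  ultimately show False
    using open_not_negligible[OF T] by blast
qed

text \<open>In the unit ball |x|^2 <= 1 <= |x|^(-\<nu>), so the quadratic term at most doubles the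
  constant.\<close>

lemma barrier_le_power:
  assumes "norm x < 1" "x \<noteq> 0" "0 \<le> \<nu>" "0 \<le> A"
  shows "barrier \<nu> A x \<le> 2 * A * norm x powr (- \<nu>)"
proof -
  have n: "0 < norm x" using assms by simp
  have "(x \<bullet> x) powr (- \<nu> / 2) = norm x powr (- \<nu>)"
    using powr_powr[of "norm x" 2 "- \<nu> / 2"] n by (simp add: power2_norm_eq_inner powr_numeral)
  moreover have "x \<bullet> x \<le> 1"
    using assms(1) power_le_one[of "norm x" 2] by (simp add: power2_norm_eq_inner)
  moreover have "1 \<le> norm x powr (- \<nu>)"
    using powr_mono2'[of "- \<nu>" "norm x" 1] assms(1,3) n by simp
  ultimately have "(x \<bullet> x) powr (- \<nu> / 2) + x \<bullet> x \<le> 2 * norm x powr (- \<nu>)" by simp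
  from mult_left_mono[OF this assms(4)] show ?thesis
    by (simp add: barrier_def mult_ac)
qed

lemma hardy_solution_bounded_by_power:
  fixes \<Omega> :: "'a::euclidean_space set"
  assumes \<Omega>: "open \<Omega>" "0 \<in> \<Omega>" and dim: "DIM('a) \<ge> 3"
    and \<nu>: "0 < \<nu>" and \<mu>: "0 \<le> \<mu>" "\<nu> * (real DIM('a) - 2 - \<nu>) = \<mu>"
    and pq: "1 \<le> p" "p < q" and sol: "hardy_solution \<mu> p q \<Omega> u"
  shows "bounded_by_power_near_0 \<nu> \<Omega> u"
proof -
  define M where "M = lebesgue_on \<Omega>"
  from sol obtain g1 where H01: "H01 \<Omega> u" and Lq: "Lp (q + 1) \<Omega> u" and pos: "AE x in M. 0 < u x"
    and g1: "has_weak_gradient \<Omega> u g1"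
    and weak: "\<And>\<phi>. test_function \<Omega> \<phi> \<Longrightarrow>
      (LINT x|M. g1 x \<bullet> grad \<phi> x) - \<mu> * (LINT x|M. u x / (norm x)\<^sup>2 * \<phi> x)
      = (LINT x|M. u x powr p * \<phi> x) - (LINT x|M. u x powr q * \<phi> x)"
    unfolding hardy_solution_def M_def by blast
  from H01 obtain g \<phi> where u2: "Lp 2 \<Omega> u" and g: "has_weak_gradient \<Omega> u g" "Lp 2 \<Omega> g"
    and test: "\<And>k. test_function \<Omega> (\<phi> k)"
    and D: "(\<lambda>k. LINT x|M. (\<phi> k x - u x)\<^sup>2) \<longlonglongrightarrow> 0"
    and E: "(\<lambda>k. LINT x|M. (norm (grad (\<phi> k) x - g x))\<^sup>2) \<longlonglongrightarrow> 0"
    unfolding H01_def M_def by blast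
  have L2u: "L2 M u" and L2g: "g \<in> borel_measurable M" "L2 M (\<lambda>x. norm (g x))"
    using u2 g(2) by (auto simp: Lp_def L2_def M_def powr_numeral)
  have D': "(\<lambda>k. L2_norm M (\<lambda>x. u x - \<phi> k x)) \<longlonglongrightarrow> 0"
    using tendsto_real_sqrt[OF D] by (simp add: L2_norm_def power2_commute)
  have E': "(\<lambda>k. L2_norm M (\<lambda>x. norm (g x - grad (\<phi> k) x))) \<longlonglongrightarrow> 0"
    using tendsto_real_sqrt[OF E] by (simp add: L2_norm_def norm_minus_commute)
  obtain A where A: "A > 0"
    "\<And>s. A \<le> s \<Longrightarrow> \<mu> + 2 * real DIM('a) + 1 \<le> s powr (q - 1) - s powr (p - 1)"
    using powr_difference_unbounded[OF pq, of "\<mu> + 2 * real DIM('a) + 1"] \<mu>(1) by auto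
  have le: "AE x in M. x \<noteq> 0 \<longrightarrow> u x \<le> barrier \<nu> A x"
    unfolding M_def
  proof (rule comparison_principle[OF \<Omega>(1) dim \<nu> \<mu> pq(1) less_imp_le[OF pq(2)] A])
    show "integrable (lebesgue_on \<Omega>) (\<lambda>x. u x powr p * \<psi> x)"
      and "integrable (lebesgue_on \<Omega>) (\<lambda>x. u x powr q * \<psi> x)" if "test_function \<Omega> \<psi>" for \<psi>
      using integrable_powr_mult_test_function[OF \<Omega>(1) L2u[unfolded M_def] pos[unfolded M_def] Lq that] pq by auto
    show "(LINT x|lebesgue_on \<Omega>. g x \<bullet> grad \<psi> x) - \<mu> * (LINT x|lebesgue_on \<Omega>. u x / (norm x)\<^sup>2 * \<psi> x)
      = (LINT x|lebesgue_on \<Omega>. u x powr p * \<psi> x) - (LINT x|lebesgue_on \<Omega>. u x powr q * \<psi> x)"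
      if "test_function \<Omega> \<psi>" for \<psi>
      \<comment> \<open>The weak gradient in the equation and the one approximated in
        \<open>H01\<close> are separate existential witnesses; their pairings with gradients of test
        functions agree.\<close>
      using weak[OF that] weak_gradient_pairing_unique[OF \<Omega>(1) g(1) g1 that] by (simp add: M_def)
  qed (use L2u L2g pos[unfolded M_def] test D' E' in \<open>auto simp: M_def\<close>)
  obtain \<rho> where \<rho>: "\<rho> > 0" "ball 0 \<rho> \<subseteq> \<Omega>"
    using \<Omega> open_contains_ball by blast
  \<comment> \<open>The ball must lie in \<Omega> and have radius at most 1, so that |x|^2 can be
    absorbed into |x|^(-\<nu>).\<close>
  define S where "S = ball (0::'a) (min \<rho> 1) - {0}"
  have S: "open S" "S \<subseteq> \<Omega>" using \<rho> by (auto simp: S_def)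
  have "AE x in lebesgue. x \<in> \<Omega> \<longrightarrow> x \<noteq> 0 \<longrightarrow> u x \<le> barrier \<nu> A x"
    using le unfolding M_def by (subst (asm) AE_restrict_space_iff) (use \<Omega>(1) in auto)
  then have "AE x in lebesgue. x \<in> S \<longrightarrow> u x \<le> 2 * A * norm x powr (- \<nu>)"
  proof eventually_elim
    case (elim x)
    show ?case
    proof
      assume x: "x \<in> S"
      then have "u x \<le> barrier \<nu> A x" using elim S(2) by (auto simp: S_def)
      also have "\<dots> \<le> 2 * A * norm x powr (- \<nu>)"
        using x \<nu> A(1) by (intro barrier_le_power) (auto simp: S_def)
      finally show "u x \<le> 2 * A * norm x powr (- \<nu>)" .
    qed
  qed
  then have AE_S: "AE x in lebesgue_on S. u x \<le> 2 * A * norm x powr (- \<nu>)"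
    using S(1) by (simp add: AE_restrict_space_iff)
  have "u x \<le> 2 * A * norm x powr (- \<nu>)" if "continuous_on (\<Omega> - {0}) u" "x \<in> S" for x
  proof -
    have "S \<subseteq> \<Omega> - {0}" using S(2) by (auto simp: S_def)
    then have "continuous_on S (\<lambda>x. u x - 2 * A * norm x powr (- \<nu>))"
      using that(1) by (intro continuous_intros continuous_on_subset[OF that(1)]) (auto simp: S_def)
    from AE_lebesgue_on_continuous_le[OF S(1) this _ that(2)] AE_S show ?thesis by simp
  qed
  then show ?thesis
    unfolding bounded_by_power_near_0_def
    using AE_S A(1) \<rho> unfolding S_def
    by (intro exI[of _ "2 * A"] conjI exI[of _ "min \<rho> 1"]) auto
qed

theorem theorem1p4:
  fixes \<Omega> :: "(real ^ 'n) set" and N :: nat and \<mu> \<nu> p q :: real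
  assumes "N = CARD('n)" and "N \<ge> 3"
    and "0 < \<mu>" and "\<mu> < mu_bar N"
    and "\<nu> = sqrt (mu_bar N) - sqrt (mu_bar N - \<mu>)"
    and "q > p" and "p \<ge> crit_exp N - 1"
    and "smooth_domain \<Omega>" and "0 \<in> \<Omega>"
  shows "(p = crit_exp N - 1 \<longrightarrow>
            (\<forall>u. hardy_solution \<mu> p q \<Omega> u \<longrightarrow> bounded_by_power_near_0 \<nu> \<Omega> u)) \<and>
         (p > crit_exp N - 1 \<and> q > (p - 1) * (real N / 2) - 1 \<longrightarrow>
            (\<forall>u. hardy_solution \<mu> p q \<Omega> u \<longrightarrow> bounded_by_power_near_0 \<nu> \<Omega> u))"
proof -
  have dim: "DIM(real ^ 'n) = N" using assms(1) by simp
  have "sqrt (mu_bar N - \<mu>) < sqrt (mu_bar N)"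
    using assms(3) by simp
  then have \<nu>: "0 < \<nu>" using assms(5) by simp
  have e: "real N - 2 = 2 * sqrt (mu_bar N)"
    using assms(2) by (simp add: mu_bar_def)
  \<comment> \<open>With a = sqrt (mu_bar N) and b = sqrt (mu_bar N - \<mu>) one has N - 2 = 2 a and
    \<nu> = a - b, so N - 2 - \<nu> = a + b and the indicial product is a difference of
    squares.\<close>
  have "(a - b) * (2 * a - (a - b)) = a\<^sup>2 - b\<^sup>2" for a b :: real
    by (simp add: power2_eq_square algebra_simps)
  then have "\<nu> * (real N - 2 - \<nu>) = (sqrt (mu_bar N))\<^sup>2 - (sqrt (mu_bar N - \<mu>))\<^sup>2"
    unfolding assms(5) e .
  also have "\<dots> = \<mu>"
    using assms(3,4) by simp
  finally have indicial: "\<nu> * (real DIM(real ^ 'n) - 2 - \<nu>) = \<mu>"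
    unfolding dim .
  \<comment> \<open>This provides p >= 1, on which both the choice of A and the bound of u^p by u +
    u^q rest.\<close>
  have "crit_exp N \<ge> 2"
    using assms(2) by (simp add: crit_exp_def field_simps)
  then have p: "1 \<le> p" using assms(7) by simp
  have "open \<Omega>" using assms(8) by (simp add: smooth_domain_def)
  then have "bounded_by_power_near_0 \<nu> \<Omega> u" if "hardy_solution \<mu> p q \<Omega> u" for u
    using hardy_solution_bounded_by_power[OF _ assms(9) _ \<nu> _ indicial p assms(6) that] assms(2,3)
    unfolding dim by simp
  then show ?thesis by blast
qed

end
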